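(* Let $K\subset\mathbb{R}^2$ be a compact strictly convex set of area $F$ bounded by a curve $\Gamma=\partial K$ of class $\mathcal{C}^2$ and length $L$. Let $F_e$ be the area with multiplicities enclosed by the evolute of $\Gamma$, let $\Delta=L^2-4\pi F$ be the isoperimetric deficit, and for $P\notin K$ let $\omega=\omega(P)$ be the visual angle of $\Gamma$ from $P$. Then $$\pi|F_e|-\Delta\ \geq\ \frac54 L^2+5\int_{P\notin K}\Big(\omega-\sin\omega-\frac23\sin^3\omega\Big)\,dP .$$ The right hand side of this inequality is a strictly positive quantity except when $\pi|F_e|-\Delta=0$, in which case it also vanishes.
   Context: Let $p(\varphi)=\sup\{\langle x,(\cos\varphi,\sin\varphi)\rangle : x\in K\}$ be the ($2\pi$-periodic) support function of $K$. "Strictly convex set bounded by a curve of class $\mathcal{C}^2$" means that $p$ is of class $\mathcal{C}^2$ and $p(\varphi)+p''(\varphi)>0$ for every $\varphi$. With $N(\varphi)=(\cos\varphi,\sin\varphi)$ the boundary is $\gamma(\varphi)=p(\varphi)N(\varphi)+p'(\varphi)N'(\varphi)$, with $L=\int_0^{2\pi}p\,d\varphi$ and $F=\frac12\int_0^{2\pi}(p^2-p'^2)\,d\varphi$. The evolute of $\Gamma$ is the envelope of its normal lines, $\tilde\gamma=\gamma-(p+p'')N$; it is the envelope of the lines $x\cos t+y\sin t=f(t)$ with $f(t)=p'(t-\pi/2)$. The area with multiplicities of the curve enveloped by a family $x\cos t+y\sin t=f(t)$, with $f$ $2\pi$-periodic, is $\frac12\int_0^{2\pi}(f^2-f'^2)\,dt$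 (equal to $\frac12\int f(f+f'')\,dt$ when $f$ is $\mathcal{C}^2$). Thus $F_e=\frac12\int_0^{2\pi}(p'^2-p''^2)\,d\varphi\le 0$. For $P\notin K$, the visual angle $\omega(P)\in(0,\pi)$ is the angle between the two tangent lines from $P$ to $\Gamma$ (the angle under which $K$ is seen from $P$), and $dP$ is the area (Lebesgue) measure on the plane. *)

theory Defs
  imports "HOL-Analysis.Analysis"
begin

definition dir :: "real \<Rightarrow> real^2" where
  "dir \<phi> = vector [cos \<phi>, sin \<phi>]"

definition dir' :: "real \<Rightarrow> real^2" where
  "dir' \<phi> = vector [- sin \<phi>, cos \<phi>]"

definition supp :: "(real^2) set \<Rightarrow> real \<Rightarrow> real" where
  "supp K \<phi> = (SUP x\<in>K. x \<bullet> dir \<phi>)"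

definition C2_fun :: "(real \<Rightarrow> real) \<Rightarrow> bool" where
  "C2_fun f \<longleftrightarrow>
     (\<forall>t. f differentiable at t) \<and> (\<forall>t. deriv f differentiable at t) \<and>
     continuous_on UNIV (deriv (deriv f))"

text \<open>A compact strictly convex set bounded by a curve of class C2: smoothness and strict
  convexity are expressed through the support function (\<open>p + p''\<close> is the radius of curvature
  of the boundary). Nonemptiness is needed for \<^const>\<open>supp\<close> to be a genuine supremum.\<close>

definition strictly_convex_C2_body :: "(real^2) set \<Rightarrow> bool" where
  "strictly_convex_C2_body K \<longleftrightarrow>
     compact K \<and> convex K \<and> K \<noteq> {} \<and>
     C2_fun (supp K) \<and> (\<forall>\<phi>. supp K \<phi> + deriv (deriv (supp K)) \<phi> > 0)"

text \<open>The boundary point with outer unit normal \<^term>\<open>dir \<phi>\<close>; the tangent line there is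
  the set of all \<open>x\<close> with \<^term>\<open>x \<bullet> dir \<phi> = supp K \<phi>\<close>.\<close>

definition bdry :: "(real^2) set \<Rightarrow> real \<Rightarrow> real^2" where
  "bdry K \<phi> = supp K \<phi> *\<^sub>R dir \<phi> + deriv (supp K) \<phi> *\<^sub>R dir' \<phi>"

text \<open>Length over one period of a continuously differentiable closed curve with parameter
  of period \<open>2 * pi\<close>.\<close>

definition closed_curve_length :: "(real \<Rightarrow> real^2) \<Rightarrow> real" where
  "closed_curve_length g = integral {0..2*pi} (\<lambda>t. norm (vector_derivative g (at t)))"

text \<open>Area with multiplicities of the curve enveloped by the lines
  \<^term>\<open>x \<bullet> dir t = f t\<close>, for \<open>f\<close> of period \<open>2 * pi\<close>.\<close>

definition envelope_area :: "(real \<Rightarrow> real) \<Rightarrow> real" where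
  "envelope_area f = 1/2 * integral {0..2*pi} (\<lambda>t. (f t)\<^sup>2 - (deriv f t)\<^sup>2)"

definition evolute :: "(real^2) set \<Rightarrow> real \<Rightarrow> real^2" where
  "evolute K \<phi> = bdry K \<phi> - (supp K \<phi> + deriv (deriv (supp K)) \<phi>) *\<^sub>R dir \<phi>"

text \<open>The evolute is the envelope of the normal lines. The normal line at the boundary point
  with parameter \<open>t - pi/2\<close> has unit normal \<^term>\<open>dir t\<close>, so it is the set of all \<open>x\<close> with
  \<open>x \<bullet> dir t = evolute_supp K t\<close>; the next two lemmas confirm this for its base point and for
  its point of contact with the evolute.\<close>

definition evolute_supp :: "(real^2) set \<Rightarrow> real \<Rightarrow> real" where
  "evolute_supp K t = deriv (supp K) (t - pi/2)"

lemma dir_shift: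
  "dir (t - pi/2) \<bullet> dir t = 0" "dir' (t - pi/2) = dir t"
  by (simp_all add: dir_def dir'_def inner_vec_def sum_2 sin_diff cos_diff)

lemma dir_inner_self: "dir t \<bullet> dir t = 1"
  by (simp add: dir_def inner_vec_def sum_2 flip: power2_eq_square)

lemma bdry_on_normal_line: "bdry K (t - pi/2) \<bullet> dir t = evolute_supp K t"
  by (simp add: bdry_def evolute_supp_def inner_add_left dir_shift dir_inner_self)

lemma evolute_on_normal_line: "evolute K (t - pi/2) \<bullet> dir t = evolute_supp K t"
  by (simp add: evolute_def inner_diff_left bdry_on_normal_line dir_shift)

definition evolute_area :: "(real^2) set \<Rightarrow> real" where
  "evolute_area K = envelope_area (evolute_supp K)"

definition vec_angle :: "real^2 \<Rightarrow> real^2 \<Rightarrow> real" where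
  "vec_angle u v = arccos (u \<bullet> v / (norm u * norm v))"

definition tangency_points :: "(real^2) set \<Rightarrow> real^2 \<Rightarrow> (real^2) set" where
  "tangency_points K P = {bdry K \<phi> |\<phi>. P \<bullet> dir \<phi> = supp K \<phi>}"

text \<open>The angle at \<open>P\<close> between the two tangents from \<open>P\<close>, measured between the rays towards the
  two points of contact (so that it is the angle under which \<open>K\<close> is seen, with values in
  \<open>{0<..<pi}\<close>). For \<^term>\<open>P \<in> K\<close> there are fewer than two points of contact and the
  value is unspecified.\<close>

definition visual_angle :: "(real^2) set \<Rightarrow> real^2 \<Rightarrow> real" where
  "visual_angle K P =
     (THE w. \<exists>A B. A \<noteq> B \<and> tangency_points K P = {A, B} \<and> w = vec_angle (A - P) (B - P))"

end

theory Submission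
  imports Defs "HOL-Real_Asymp.Real_Asymp"
begin

text \<open>Write \<open>p\<close> for the support function. A point outside \<open>K\<close> is the intersection of the support
  lines with normals at angles \<open>x\<close> and \<open>x + t\<close>, \<open>0 < t < pi\<close>; there the visual angle is
  \<open>pi - t\<close> and the area element is \<open>a * b / sin t dx dt\<close>, with \<open>a\<close>, \<open>b\<close> the lengths of the tangent
  segments. Integrating over \<open>x\<close> turns \<open>a * b\<close> into an expression in the autocorrelation of \<open>p\<close>, and
  two integrations by parts in \<open>t\<close> evaluate the integral of the theorem as
  \<open>- pi * F - 3/2 * N\<close>, where \<open>N\<close> is the squared modulus of the integral of \<open>p x * cis (2 * x)\<close>.
  Let \<open>q\<close> be \<open>p\<close> without its harmonics of order at most 2, and let \<open>A\<close>, \<open>B\<close>, \<open>C\<close> be the integrals of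
  \<open>q\<^sup>2\<close>, \<open>q'\<^sup>2\<close>, \<open>q''\<^sup>2\<close>. Then the right-hand side is \<open>5 * pi / 2 * (B - A)\<close> and
  \<open>- pi * Fe - \<Delta> = pi / 2 * (C - 5 * B + 4 * A)\<close>, so everything follows from \<open>B \<ge> 9 * A\<close>
  (Wirtinger's inequality for \<open>q\<close>) and the nonnegativity of the integral of \<open>(q'' + 9 * q)\<^sup>2\<close>.\<close>

section \<open>Trigonometric approximation\<close>

text \<open>On the harmonic of order n, \<open>- pi * Fe - \<Delta>\<close> has weight proportional
  to (n^2 - 1)(n^2 - 4) and the right-hand side, with the same factor, weight 5(n^2 - 1). The
  difference (n^2 - 1)(n^2 - 9) is nonnegative exactly from n = 3 on (and at n = 0, 1); this is the
  origin of the 9. Order 1 is a translation and has weight 0 on both sides; on the right the terms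
  in L^2 and N cancel the orders 0 and 2, so both sides depend on \<open>q\<close> alone. No
  infinite series is manipulated: Bessel's inequality for \<open>q'\<close> and a uniform
  approximation of \<open>q\<close> by trigonometric polynomials replace Parseval's identity. The
  geometric obstacle is that the exterior of \<open>K\<close> is unbounded. In the coordinates (x,
  t) it becomes a bounded rectangle, where the area density may grow like (pi - t)^-3 near t = pi.
  The kernel vanishes to third order there, so the transformed integrand is bounded, which gives
  integrability and Fubini at once.\<close>

inductive trig_poly :: "(real \<Rightarrow> real) \<Rightarrow> bool" where
  cos: "trig_poly (\<lambda>x. c * cos (of_int n * x))"
| sin: "trig_poly (\<lambda>x. c * sin (of_int n * x))"
| add: "trig_poly f \<Longrightarrow> trig_poly g \<Longrightarrow> trig_poly (\<lambda>x. f x + g x)"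

text \<open>Product-to-sum formulas produce the frequency \<open>n - m\<close>, which may be
  negative; integer frequencies in \<open>trig_poly\<close> spare a case split here.\<close>

lemma trig_poly_mult_cos: "trig_poly f \<Longrightarrow> trig_poly (\<lambda>x. f x * (d * cos (of_int m * x)))"
proof (induction rule: trig_poly.induct)
  case (cos c n)
  have "(\<lambda>x. c * cos (of_int n * x) * (d * cos (of_int m * x))) =
    (\<lambda>x. (c*d/2) * cos (of_int (n - m) * x) + (c*d/2) * cos (of_int (n + m) * x))"
    by (simp add: cos_add cos_diff algebra_simps)
  then show ?case by (simp only:) (intro trig_poly.intros)
next
  case (sin c n)
  have "(\<lambda>x. c * sin (of_int n * x) * (d * cos (of_int m * x))) =
    (\<lambda>x. (c*d/2) * sin (of_int (n - m) * x) + (c*d/2) * sin (of_int (n + m) * x))"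
    by (simp add: sin_add sin_diff algebra_simps)
  then show ?case by (simp only:) (intro trig_poly.intros)
next
  case (add f g)
  then show ?case by (auto intro: trig_poly.intros simp: distrib_right)
qed

lemma trig_poly_mult_sin: "trig_poly f \<Longrightarrow> trig_poly (\<lambda>x. f x * (d * sin (of_int m * x)))"
proof (induction rule: trig_poly.induct)
  case (cos c n)
  have "(\<lambda>x. c * cos (of_int n * x) * (d * sin (of_int m * x))) =
    (\<lambda>x. (c*d/2) * sin (of_int (n + m) * x) + (-(c*d/2)) * sin (of_int (n - m) * x))"
    by (simp add: sin_add sin_diff algebra_simps)
  then show ?case by (simp only:) (intro trig_poly.intros)
next
  case (sin c n)
  have "(\<lambda>x. c * sin (of_int n * x) * (d * sin (of_int m * x))) =
    (\<lambda>x. (c*d/2) * cos (of_int (n - m) * x) + (-(c*d/2)) * cos (of_int (n + m) * x))"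
    by (simp add: cos_add cos_diff algebra_simps)
  then show ?case by (simp only:) (intro trig_poly.intros)
next
  case (add f g)
  then show ?case by (auto intro: trig_poly.intros simp: distrib_right)
qed

lemma trig_poly_mult:
  assumes f: "trig_poly f" and g: "trig_poly g"
  shows "trig_poly (\<lambda>x. f x * g x)"
  using g
proof (induction rule: trig_poly.induct)
  case (add g h)
  then show ?case by (auto intro: trig_poly.intros simp: distrib_left)
qed (use f in \<open>auto intro: trig_poly_mult_cos trig_poly_mult_sin\<close>)

text \<open>A real-linear functional on the plane is determined by its values at \<open>1\<close>
  and \<open>\<i>\<close>, so on the unit circle it is a combination of cosine and sine; products
  supply the higher frequencies.\<close>

lemma trig_poly_real_polynomial:
  "real_polynomial_function g \<Longrightarrow> trig_poly (\<lambda>x. g (cis x))"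
proof (induction rule: real_polynomial_function.induct)
  case (linear f)
  interpret bounded_linear f by fact
  have "f (cis x) = f 1 * cos (of_int 1 * x) + f \<i> * sin (of_int 1 * x)" for x
  proof -
    have "cis x = cos x *\<^sub>R 1 + sin x *\<^sub>R \<i>" by (simp add: complex_eq_iff)
    then show ?thesis by (simp add: add scaleR del: scaleR_conv_of_real)
  qed
  then show ?case by (simp only:) (intro trig_poly.intros)
next
  case (const c)
  show ?case using trig_poly.cos[of c 0] by simp
qed (auto intro: trig_poly_mult trig_poly.add)

lemma periodic_of_int:
  fixes q :: "real \<Rightarrow> 'a" and k :: int
  assumes "\<And>x. q (x + 2*pi) = q x"
  shows "q (x + 2*pi * of_int k) = q x"
proof -
  have n: "q (x + 2*pi * real n) = q x" for n x
  proof (induction n arbitrary: x)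
    case (Suc n)
    have "q (x + 2*pi * real (Suc n)) = q ((x + 2*pi * real n) + 2*pi)" by (simp add: algebra_simps)
    then show ?case using assms Suc by simp
  qed simp
  show ?thesis
  proof (cases "k \<ge> 0")
    case True then show ?thesis using n[of x "nat k"] by simp
  next
    case False then show ?thesis using n[of "x + 2*pi * of_int k" "nat (-k)"] by (simp add: algebra_simps)
  qed
qed

lemma periodic_cis_eq:
  assumes "\<And>x. q (x + 2*pi) = q x" "cis x = cis y"
  shows "q x = q (y::real)"
proof -
  have "sin x = sin y \<and> cos x = cos y" using assms(2) by (simp add: complex_eq_iff)
  then obtain n :: int where "x = y + 2*pi * of_int n" by (metis sin_cos_eq_iff mult.commute mult.assoc)
  then show ?thesis using periodic_of_int[of q y n] assms(1) by simp
qed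

text \<open>A periodic function factors through the unit circle as \<open>q (Arg z)\<close>, so
  Stone-Weierstrass on the circle applies once this factor is known to be continuous.\<close>

lemma trig_poly_dense:
  assumes per: "\<And>x. q (x + 2*pi) = (q x::real)" and cont: "continuous_on UNIV q" and e: "e > 0"
  obtains T where "trig_poly T" "\<And>x. \<bar>q x - T x\<bar> < e"
proof -
  let ?S = "sphere (0::complex) 1"
  have eq: "q (Arg z) = q (Arg2pi z)" if "z \<noteq> 0" for z
  proof (rule periodic_cis_eq[of q])
    have "cmod z * cos (Arg z) = cmod z * cos (Arg2pi z)" "cmod z * sin (Arg z) = cmod z * sin (Arg2pi z)"
      using cos_Arg2pi[of z] sin_Arg2pi[of z] rcis_cmod_Arg[of z] by (simp_all add: complex_eq_iff)
    then show "cis (Arg z) = cis (Arg2pi z)" using that by (auto simp: complex_eq_iff)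
  qed (rule per)
  have c1: "isCont q x" for x using cont by (simp add: continuous_on_eq_continuous_at)
  have "continuous_on ?S (\<lambda>z. q (Arg z))"
    unfolding continuous_on_eq_continuous_within
  proof
    fix z :: complex assume z: "z \<in> ?S"
    then have nz: "z \<noteq> 0" by auto
    show "continuous (at z within ?S) (\<lambda>z. q (Arg z))"
    proof (cases "z \<in> \<real>\<^sub>\<le>\<^sub>0")
      case False
      then have "isCont (\<lambda>z. q (Arg z)) z" using continuous_at_Arg c1 by (auto intro: isCont_o2)
      then show ?thesis by (rule continuous_at_imp_continuous_at_within)
    next
      case True
      \<comment> \<open>On the branch cut of \<open>Arg\<close> the other branch
        \<open>Arg2pi\<close> is continuous, and by periodicity \<open>q\<close> does not
        distinguish the two.\<close>
      then have "z \<notin> \<real>\<^sub>\<ge>\<^sub>0" using nz by (auto simp: complex_nonpos_Reals_iff complex_nonneg_Reals_iff complex_eq_iff)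
      then have "isCont (\<lambda>z. q (Arg2pi z)) z" using continuous_at_Arg2pi c1 by (auto intro: isCont_o2)
      then have "continuous (at z within ?S) (\<lambda>z. q (Arg2pi z))" by (rule continuous_at_imp_continuous_at_within)
      then show ?thesis
        by (rule continuous_transform_within[OF _ zero_less_one]) (use z in \<open>auto intro!: eq[symmetric]\<close>)
    qed
  qed
  then obtain g where g: "real_polynomial_function g" "\<And>z. z \<in> ?S \<Longrightarrow> \<bar>q (Arg z) - g z\<bar> < e"
    using Stone_Weierstrass_real_polynomial_function[of ?S "\<lambda>z. q (Arg z)" e] e by auto
  have "q (Arg (cis x)) = q x" for x
    by (rule periodic_cis_eq[of q, OF per]) (simp add: cis_Arg)
  then have "\<bar>q x - g (cis x)\<bar> < e" for x using g(2)[of "cis x"] by simp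
  with trig_poly_real_polynomial[OF g(1)] that show thesis by blast
qed

section \<open>Wirtinger's inequality\<close>

lemma integral_cos_int:
  "integral {0..2*pi} (\<lambda>x. cos (of_int n * x)) = (if n = 0 then 2*pi else 0)"
proof (cases "n = 0")
  case False
  have "((\<lambda>x. cos (of_int n * x)) has_integral
      (sin (of_int n * (2*pi)) / of_int n - sin (of_int n * 0) / of_int n)) {0..2*pi}"
    by (rule fundamental_theorem_of_calculus)
       (use False in \<open>auto intro!: derivative_eq_intros simp flip: has_real_derivative_iff_has_vector_derivative\<close>)
  then show ?thesis using False sin_int_2pin[of n] by (simp add: integral_unique mult.commute)
qed simp

lemma integral_sin_int: "integral {0..2*pi} (\<lambda>x. sin (of_int n * x)) = 0"
proof (cases "n = 0")
  case False
  have "((\<lambda>x. sin (of_int n * x)) has_integral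
      ((- cos (of_int n * (2*pi)) / of_int n) - (- cos (of_int n * 0) / of_int n))) {0..2*pi}"
    by (rule fundamental_theorem_of_calculus)
       (use False in \<open>auto intro!: derivative_eq_intros simp flip: has_real_derivative_iff_has_vector_derivative\<close>)
  then show ?thesis using False cos_int_2pin[of n] by (simp add: integral_unique mult.commute)
qed simp

section \<open>The trigonometric basis and its orthogonality relations\<close>

definition trig :: "nat \<times> bool \<Rightarrow> real \<Rightarrow> real" where
  "trig j x = (if snd j then cos (real (fst j) * x) else sin (real (fst j) * x))"

text \<open>Squared norms over one period. Index pairs let sums run over the full product
  \<open>{..N} \<times> UNIV\<close>; the price is the zero function at \<open>(0, False)\<close>,
  of norm 0.\<close>

definition trig_norm2 :: "nat \<times> bool \<Rightarrow> real" where
  "trig_norm2 j = (if fst j \<noteq> 0 then pi else if snd j then 2*pi else 0)"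

lemma continuous_on_trig [continuous_intros]: "continuous_on S (trig j)"
  unfolding trig_def by (cases "snd j") (auto intro!: continuous_intros)

lemma continuous_on_trig_o [continuous_intros]:
  "continuous_on S f \<Longrightarrow> continuous_on S (\<lambda>x. trig j (f x))"
  using continuous_on_compose2[OF continuous_on_trig[of UNIV]] by blast

lemma integral_trig_mult:
  "integral {0..2*pi} (\<lambda>x. trig i x * trig j x) = (if i = j then trig_norm2 i else 0)"
proof -
  obtain m a n b where ij: "i = (m, a)" "j = (n, b)" by fastforce
  have int: "(\<lambda>x. cos (of_int k * x)) integrable_on {0..2*pi}"
    "(\<lambda>x. sin (of_int k * x)) integrable_on {0..2*pi}" for k
    by (auto intro!: integrable_continuous_real continuous_intros)
  let ?d = "int m - int n" and ?s = "int m + int n"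
  have cc: "cos (real m * x) * cos (real n * x) = 1/2 * (cos (of_int ?d * x) + cos (of_int ?s * x))"
   and ss: "sin (real m * x) * sin (real n * x) = 1/2 * (cos (of_int ?d * x) - cos (of_int ?s * x))"
   and sc: "sin (real m * x) * cos (real n * x) = 1/2 * (sin (of_int ?d * x) + sin (of_int ?s * x))"
   and cs: "cos (real m * x) * sin (real n * x) = 1/2 * (sin (of_int ?s * x) - sin (of_int ?d * x))" for x
    by (simp_all add: cos_add cos_diff sin_add sin_diff algebra_simps)
  show ?thesis
    unfolding ij trig_def trig_norm2_def fst_conv snd_conv
    by (cases a; cases b; simp only: if_True if_False cc ss sc cs integral_mult_right
          integral_add[OF int(1) int(1)] integral_add[OF int(2) int(2)]
          integral_diff[OF int(1) int(1)] integral_diff[OF int(2) int(2)]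
          integral_cos_int integral_sin_int) auto
qed

lemma trig_poly_expansion:
  "trig_poly f \<Longrightarrow> \<exists>N a. \<forall>x. f x = (\<Sum>j\<in>{..N} \<times> UNIV. a j * trig j x)"
proof (induction rule: trig_poly.induct)
  case (cos c n)
  let ?k = "nat \<bar>n\<bar>"
  have "c * cos (of_int n * x) = (\<Sum>j\<in>{..?k} \<times> UNIV. (if j = (?k, True) then c else 0) * trig j x)" for x
  proof -
    have "cos (of_int n * x) = trig (?k, True) x"
      by (cases "n \<ge> 0") (auto simp: trig_def)
    then show ?thesis by (simp add: if_distrib[of "\<lambda>y. y * _"] sum.delta cong: if_cong)
  qed
  then show ?case by (intro exI allI)
next
  case (sin c n)
  let ?k = "nat \<bar>n\<bar>"
  have "c * sin (of_int n * x) = (\<Sum>j\<in>{..?k} \<times> UNIV. (if j = (?k, False) then c * sgn (of_int n) else 0) * trig j x)" for x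
  proof -
    have "sin (of_int n * x) = sgn (of_int n) * trig (?k, False) x"
      by (cases "n > 0"; cases "n = 0") (auto simp: trig_def)
    then show ?thesis by (simp add: if_distrib[of "\<lambda>y. y * _"] sum.delta cong: if_cong)
  qed
  then show ?case by (intro exI allI)
next
  case (add f g)
  then obtain M N a b where
    f: "\<And>x. f x = (\<Sum>j\<in>{..M} \<times> UNIV. a j * trig j x)" and
    g: "\<And>x. g x = (\<Sum>j\<in>{..N} \<times> UNIV. b j * trig j x)" by blast
  let ?K = "max M N"
  let ?c = "\<lambda>j. (if fst j \<le> M then a j else 0) + (if fst j \<le> N then b j else 0)"
  have "f x + g x = (\<Sum>j\<in>{..?K} \<times> UNIV. ?c j * trig j x)" for x
  proof -
    have "f x = (\<Sum>j\<in>{..?K} \<times> UNIV. (if fst j \<le> M then a j else 0) * trig j x)"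
      unfolding f by (rule sum.mono_neutral_cong_left) auto
    moreover have "g x = (\<Sum>j\<in>{..?K} \<times> UNIV. (if fst j \<le> N then b j else 0) * trig j x)"
      unfolding g by (rule sum.mono_neutral_cong_left) auto
    ultimately show ?thesis by (simp add: sum.distrib distrib_right)
  qed
  then show ?case by (intro exI allI)
qed

text \<open>The coefficients are arbitrary because they come from different sources: Fourier
  coefficients for Bessel's inequality and for the projection, coefficients of an approximating
  polynomial in \<open>wirtinger\<close>.\<close>

lemma integral_sq_diff_trig:
  fixes q :: "real \<Rightarrow> real"
  assumes q: "continuous_on {0..2*pi} q" and J: "finite J"
  shows "integral {0..2*pi} (\<lambda>x. (q x - (\<Sum>j\<in>J. a j * trig j x))\<^sup>2) =
    integral {0..2*pi} (\<lambda>x. (q x)\<^sup>2) - 2 * (\<Sum>j\<in>J. a j * integral {0..2*pi} (\<lambda>x. q x * trig j x))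
    + (\<Sum>j\<in>J. (a j)\<^sup>2 * trig_norm2 j)"
proof -
  note [continuous_intros] = q
  have int: "f integrable_on {0..2*pi}" if "continuous_on {0..2*pi} f" for f :: "real \<Rightarrow> real"
    using that by (rule integrable_continuous_real)
  have eq: "(q x - (\<Sum>j\<in>J. a j * trig j x))\<^sup>2 =
      (q x)\<^sup>2 - 2 * (\<Sum>j\<in>J. a j * (q x * trig j x)) + (\<Sum>i\<in>J. \<Sum>j\<in>J. a i * a j * (trig i x * trig j x))" for x
    by (simp add: power2_diff power2_eq_square[of "sum _ _"] sum_product sum_distrib_left
        sum_distrib_right mult_ac)
  have "((\<lambda>x. (q x - (\<Sum>j\<in>J. a j * trig j x))\<^sup>2) has_integral
     (integral {0..2*pi} (\<lambda>x. (q x)\<^sup>2) - 2 * (\<Sum>j\<in>J. a j * integral {0..2*pi} (\<lambda>x. q x * trig j x))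
     + (\<Sum>i\<in>J. \<Sum>j\<in>J. a i * a j * integral {0..2*pi} (\<lambda>x. trig i x * trig j x)))) {0..2*pi}"
    unfolding eq
    by (intro has_integral_add has_integral_diff has_integral_mult_right has_integral_sum J
        integrable_integral int continuous_intros)
  then have "integral {0..2*pi} (\<lambda>x. (q x - (\<Sum>j\<in>J. a j * trig j x))\<^sup>2) =
     integral {0..2*pi} (\<lambda>x. (q x)\<^sup>2) - 2 * (\<Sum>j\<in>J. a j * integral {0..2*pi} (\<lambda>x. q x * trig j x))
     + (\<Sum>i\<in>J. \<Sum>j\<in>J. a i * a j * integral {0..2*pi} (\<lambda>x. trig i x * trig j x))"
    by (rule integral_unique)
  also have "(\<Sum>i\<in>J. \<Sum>j\<in>J. a i * a j * integral {0..2*pi} (\<lambda>x. trig i x * trig j x)) =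
     (\<Sum>j\<in>J. (a j)\<^sup>2 * trig_norm2 j)"
    by (simp add: integral_trig_mult if_distrib[of "\<lambda>y. _ * y"] sum.delta' J power2_eq_square cong: if_cong)
  finally show ?thesis .
qed

lemma integral_by_parts_periodic:
  fixes u v u' v' :: "real \<Rightarrow> real"
  assumes "\<And>x. (u has_real_derivative u' x) (at x)" "\<And>x. (v has_real_derivative v' x) (at x)"
    and "continuous_on UNIV u'" "continuous_on UNIV v'"
    and "u (2*pi) * v (2*pi) = u 0 * v 0"
  shows "integral {0..2*pi} (\<lambda>x. u' x * v x) = - integral {0..2*pi} (\<lambda>x. u x * v' x)"
proof -
  have cu: "continuous_on S u" and cv: "continuous_on S v" for S
    by (auto intro!: continuous_at_imp_continuous_on DERIV_isCont[OF assms(1)] DERIV_isCont[OF assms(2)])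
  have cu': "continuous_on S u'" and cv': "continuous_on S v'" for S
    using assms(3,4) continuous_on_subset by blast+
  have i: "(\<lambda>x. u' x * v x) integrable_on {0..2*pi}" "(\<lambda>x. u x * v' x) integrable_on {0..2*pi}"
    by (auto intro!: integrable_continuous_real continuous_intros cu cv cu' cv')
  have "((\<lambda>x. u' x * v x + u x * v' x) has_integral (u (2*pi) * v (2*pi) - u 0 * v 0)) {0..2*pi}"
    by (rule fundamental_theorem_of_calculus)
      (auto intro!: derivative_eq_intros DERIV_subset[OF assms(1)] DERIV_subset[OF assms(2)]
        simp flip: has_real_derivative_iff_has_vector_derivative)
  then have "integral {0..2*pi} (\<lambda>x. u' x * v x + u x * v' x) = 0"
    using assms(5) by (simp add: integral_unique)
  then show ?thesis using i by (simp add: integral_add)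
qed

lemma trig_coefficient_deriv:
  fixes q q' :: "real \<Rightarrow> real"
  assumes der: "\<And>x. (q has_real_derivative q' x) (at x)" and cont: "continuous_on UNIV q'"
    and per: "q (2*pi) = q 0"
  shows "integral {0..2*pi} (\<lambda>x. q' x * trig (n, b) x) =
    (if b then real n else - real n) * integral {0..2*pi} (\<lambda>x. q x * trig (n, \<not> b) x)"
proof -
  let ?s = "if b then - real n else real n"
  have d: "((\<lambda>x. trig (n, b) x) has_real_derivative ?s * trig (n, \<not> b) x) (at x)" for x
    by (cases b) (auto simp: trig_def intro!: derivative_eq_intros)
  have p: "trig (n, b) (2*pi) = trig (n, b) 0"
    using sin_int_2pin[of n] cos_int_2pin[of n] by (cases b) (auto simp: trig_def mult.commute)
  have "integral {0..2*pi} (\<lambda>x. q' x * trig (n, b) x) = - integral {0..2*pi} (\<lambda>x. q x * (?s * trig (n, \<not> b) x))"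
    by (rule integral_by_parts_periodic[OF der d cont])
      (auto intro!: continuous_intros simp: per p)
  also have "\<dots> = - (?s * integral {0..2*pi} (\<lambda>x. q x * trig (n, \<not> b) x))"
    by (simp only: mult.left_commute[of _ ?s] integral_mult_right)
  finally show ?thesis by (cases b) auto
qed

lemma sum_trig_index: "(\<Sum>j\<in>{..N} \<times> UNIV. f j) = (\<Sum>n\<le>N. f (n, True) + f (n, False))"
  for f :: "nat \<times> bool \<Rightarrow> real"
  by (subst sum.Sigma[symmetric, of "{..N}" "\<lambda>_. UNIV" "\<lambda>n b. f (n,b)", simplified]) (simp_all add: UNIV_bool add.commute)

text \<open>With \<open>C n\<close> the squared Fourier coefficients of \<open>q\<close>, Bessel
  bounds the sum of n^2 \<open>C n\<close> by the energy of \<open>q'\<close>, and a uniform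
  approximant bounds the energy of \<open>q\<close> by the sum of \<open>C n\<close> up to an error.
  Only orders n >= m occur, where \<open>C n\<close> is at most n^2 \<open>C n\<close> /
  m^2.\<close>

theorem wirtinger:
  fixes q q' :: "real \<Rightarrow> real" and m :: nat
  assumes der: "\<And>x. (q has_real_derivative q' x) (at x)" and cont: "continuous_on UNIV q'"
    and per: "\<And>x. q (x + 2*pi) = q x"
    and orth: "\<And>n b. n < m \<Longrightarrow> integral {0..2*pi} (\<lambda>x. q x * trig (n, b) x) = 0" and m: "m > 0"
  shows "(real m)\<^sup>2 * integral {0..2*pi} (\<lambda>x. (q x)\<^sup>2) \<le> integral {0..2*pi} (\<lambda>x. (q' x)\<^sup>2)"
proof -
  let ?I = "\<lambda>f :: real \<Rightarrow> real. integral {0..2*pi} f"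
  define c where "c j = ?I (\<lambda>x. q x * trig j x)" for j
  define C where "C n = (c (n, True))\<^sup>2 + (c (n, False))\<^sup>2" for n
  have cq: "continuous_on S q" for S
    by (auto intro!: continuous_at_imp_continuous_on DERIV_isCont[OF der])
  have cq': "continuous_on S q'" for S using cont continuous_on_subset by blast
  have C0: "C n = 0" if "n < m" for n using orth[OF that] by (simp add: C_def c_def)
  have Cnn: "C n \<ge> 0" for n by (simp add: C_def)
  have bessel: "(\<Sum>n\<le>N. (real n)\<^sup>2 * C n) / pi \<le> ?I (\<lambda>x. (q' x)\<^sup>2)" for N
  proof -
    let ?J = "{..N} \<times> (UNIV :: bool set)"
    define d where "d j = ?I (\<lambda>x. q' x * trig j x)" for j
    have d: "d (n, b) = (if b then real n else - real n) * c (n, \<not> b)" for n b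
      unfolding d_def c_def using per[of 0] by (intro trig_coefficient_deriv[OF der cont]) simp
    \<comment> \<open>These are the Fourier coefficients although the norm for frequency 0 is not
      pi: there the coefficient of a derivative vanishes.\<close>
    define a where "a j = d j / pi" for j
    have a: "a j * d j = (d j)\<^sup>2 / pi" "(a j)\<^sup>2 * trig_norm2 j = (d j)\<^sup>2 / pi" for j
      using d[of "fst j" "snd j"] by (auto simp: a_def trig_norm2_def power2_eq_square)
    have "0 \<le> ?I (\<lambda>x. (q' x - (\<Sum>j\<in>?J. a j * trig j x))\<^sup>2)"
      by (rule integral_nonneg) (auto intro!: integrable_continuous_real continuous_intros cq')
    also have "\<dots> = ?I (\<lambda>x. (q' x)\<^sup>2) - (\<Sum>j\<in>?J. (d j)\<^sup>2 / pi)"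
      by (subst integral_sq_diff_trig[OF cq']) (simp_all add: a flip: d_def)
    also have "(\<Sum>j\<in>?J. (d j)\<^sup>2 / pi) = (\<Sum>n\<le>N. (real n)\<^sup>2 * C n) / pi"
      unfolding sum_trig_index by (simp add: d C_def power_mult_distrib sum_divide_distrib algebra_simps add_divide_distrib)
    finally show ?thesis by simp
  qed
  have approx: "?I (\<lambda>x. (q x)\<^sup>2) \<le> ?I (\<lambda>x. (q' x)\<^sup>2) / (real m)\<^sup>2 + 2*pi*e\<^sup>2" if e: "e > 0" for e
  proof -
    obtain T where T: "trig_poly T" "\<And>x. \<bar>q x - T x\<bar> < e"
      using trig_poly_dense[OF per cq e] by blast
    obtain N a where TN: "\<And>x. T x = (\<Sum>j\<in>{..N} \<times> UNIV. a j * trig j x)"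
      using trig_poly_expansion[OF T(1)] by blast
    let ?J = "{..N} \<times> (UNIV :: bool set)"
    have "(\<lambda>x. (q x - (\<Sum>j\<in>?J. a j * trig j x))\<^sup>2) integrable_on {0..2*pi}"
      by (auto intro!: integrable_continuous_real continuous_intros cq)
    moreover have "(q x - (\<Sum>j\<in>?J. a j * trig j x))\<^sup>2 \<le> e\<^sup>2" for x
      using T(2)[of x] e by (simp add: abs_le_square_iff[symmetric] flip: TN)
    ultimately have "?I (\<lambda>x. (q x - (\<Sum>j\<in>?J. a j * trig j x))\<^sup>2) \<le> ?I (\<lambda>x. e\<^sup>2)"
      by (intro integral_le) auto
    then have 1: "?I (\<lambda>x. (q x - (\<Sum>j\<in>?J. a j * trig j x))\<^sup>2) \<le> 2*pi*e\<^sup>2" by simp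
    \<comment> \<open>Completing the square: the left side is largest at
      \<open>a j = c j / pi\<close>. For frequency 0 the coefficient \<open>c j\<close> is zero by
      orthogonality.\<close>
    have 2: "2 * (a j * c j) - (a j)\<^sup>2 * trig_norm2 j \<le> (c j)\<^sup>2 / pi" for j
    proof (cases "fst j = 0")
      case True
      then have "c j = 0" using orth[of 0 "snd j"] m by (simp add: c_def prod_eq_iff flip: True)
      then show ?thesis by (simp add: trig_norm2_def)
    next
      case False
      have "0 \<le> (a j * pi - c j)\<^sup>2 / pi" by simp
      also have "\<dots> = (a j)\<^sup>2 * pi - 2 * (a j * c j) + (c j)\<^sup>2 / pi"
        by (simp add: power2_eq_square field_simps)
      finally show ?thesis using False by (simp add: trig_norm2_def)
    qed
    have "?I (\<lambda>x. (q x)\<^sup>2) - (\<Sum>j\<in>?J. (c j)\<^sup>2 / pi) \<le>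
        ?I (\<lambda>x. (q x)\<^sup>2) - (\<Sum>j\<in>?J. 2 * (a j * c j) - (a j)\<^sup>2 * trig_norm2 j)"
      by (intro diff_left_mono sum_mono 2)
    also have "\<dots> = ?I (\<lambda>x. (q x - (\<Sum>j\<in>?J. a j * trig j x))\<^sup>2)"
      by (subst integral_sq_diff_trig[OF cq]) (simp_all add: sum_subtractf sum_distrib_left c_def)
    finally have "?I (\<lambda>x. (q x)\<^sup>2) \<le> (\<Sum>j\<in>?J. (c j)\<^sup>2 / pi) + 2*pi*e\<^sup>2" using 1 by linarith
    also have "(\<Sum>j\<in>?J. (c j)\<^sup>2 / pi) = (\<Sum>n\<le>N. C n) / pi"
      unfolding sum_trig_index by (simp add: C_def sum_divide_distrib add_divide_distrib)
    also have "\<dots> \<le> ((\<Sum>n\<le>N. (real n)\<^sup>2 * C n) / (real m)\<^sup>2) / pi"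
    proof -
      have "C n \<le> (real n)\<^sup>2 * C n / (real m)\<^sup>2" for n
      proof (cases "n < m")
        case True then show ?thesis using C0 by simp
      next
        case False
        then have "C n * (real m)\<^sup>2 \<le> C n * (real n)\<^sup>2" using Cnn by (intro mult_left_mono power_mono) auto
        then show ?thesis using m by (simp add: field_simps)
      qed
      then show ?thesis by (intro divide_right_mono) (auto simp: sum_divide_distrib intro!: sum_mono)
    qed
    also have "\<dots> \<le> ?I (\<lambda>x. (q' x)\<^sup>2) / (real m)\<^sup>2"
      using divide_right_mono[OF bessel[of N], of "(real m)\<^sup>2"] by (simp add: mult.commute)
    finally show ?thesis by simp
  qed
  have "?I (\<lambda>x. (q x)\<^sup>2) \<le> ?I (\<lambda>x. (q' x)\<^sup>2) / (real m)\<^sup>2"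
  proof (rule field_le_epsilon)
    fix e :: real assume "e > 0"
    then show "?I (\<lambda>x. (q x)\<^sup>2) \<le> ?I (\<lambda>x. (q' x)\<^sup>2) / (real m)\<^sup>2 + e"
      using approx[of "sqrt (e / (2*pi))"] by simp
  qed
  then show ?thesis using m by (simp add: field_simps)
qed

section \<open>Sturm comparison and the Crofton kernel\<close>

text \<open>The left side is the value at \<open>b\<close> of the solution of y'' + y = 0 with the
  data of \<open>h\<close> at \<open>a\<close>. Letting the contact point x run from
  \<open>a\<close> to \<open>b\<close> gives \<open>?V\<close>, with derivative
  \<open>(h x + h'' x) * sin (b - x)\<close>, and \<open>?V b = h b\<close>.\<close>

lemma sturm_comparison:
  fixes h h' h'' :: "real \<Rightarrow> real"
  assumes h: "\<And>x. (h has_real_derivative h' x) (at x)"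
    and h': "\<And>x. (h' has_real_derivative h'' x) (at x)"
    and pos: "\<And>x. h x + h'' x > 0" and ab: "a \<noteq> b" "\<bar>b - a\<bar> \<le> pi"
  shows "h a * cos (b - a) + h' a * sin (b - a) < h b"
proof -
  let ?V = "\<lambda>x. h x * cos (b - x) + h' x * sin (b - x)"
  have V: "(?V has_real_derivative (h x + h'' x) * sin (b - x)) (at x)" for x
    by (rule derivative_eq_intros refl h h' | simp add: algebra_simps)+
  have cV: "continuous_on S ?V" for S
    by (auto intro!: continuous_at_imp_continuous_on DERIV_isCont[OF V])
  have "?V a < ?V b"
  proof (cases "a < b")
    case True
    show ?thesis
    proof (rule DERIV_pos_imp_increasing_open[OF True _ cV])
      fix x assume "a < x" "x < b"
      then have "sin (b - x) > 0" using ab by (intro sin_gt_zero) auto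
      then show "\<exists>y. (?V has_real_derivative y) (at x) \<and> y > 0"
        using pos[of x] V[of x] by (blast intro: mult_pos_pos)
    qed
  next
    case False
    then have ba: "b < a" using ab by auto
    show ?thesis
    proof (rule DERIV_neg_imp_decreasing_open[OF ba _ cV])
      fix x assume "b < x" "x < a"
      then have "sin (x - b) > 0" using ab by (intro sin_gt_zero) auto
      then have "sin (b - x) < 0" by (simp add: sin_diff mult.commute)
      then show "\<exists>y. (?V has_real_derivative y) (at x) \<and> y < 0"
        using pos[of x] V[of x] by (blast intro: mult_pos_neg)
    qed
  qed
  then show ?thesis by simp
qed

lemma integral_periodic_shift:
  fixes f :: "real \<Rightarrow> real"
  assumes cont: "continuous_on UNIV f" and per: "\<And>x. f (x + 2*pi) = f x" and c: "0 \<le> c" "c \<le> 2*pi"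
  shows "integral {0..2*pi} (\<lambda>x. f (x + c)) = integral {0..2*pi} f"
proof -
  have i: "f integrable_on {a..b}" for a b
    using cont by (blast intro: integrable_continuous_real continuous_on_subset)
  have "integral {0..2*pi} (\<lambda>x. f (x + c)) = integral {c..2*pi + c} f"
    using integral_shift_real_ivl[of c c "2*pi + c" f] by simp
  also have "\<dots> = integral {c..2*pi} f + integral {2*pi..2*pi + c} f"
    using c by (intro Henstock_Kurzweil_Integration.integral_combine[symmetric] i) auto
  also have "integral {2*pi..2*pi + c} f = integral {0..c} f"
    using integral_shift_real_ivl[of "2*pi" "2*pi" "2*pi + c" f] by (simp add: per)
  also have "integral {c..2*pi} f + integral {0..c} f = integral {0..2*pi} f"
    using c by (subst add.commute, intro Henstock_Kurzweil_Integration.integral_combine i) auto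
  finally show ?thesis .
qed

text \<open>With the factor 2/3 the total in \<open>crofton_formula\<close> involves only the area
  and the second harmonic of the support function.\<close>

definition crofton_kernel :: "real \<Rightarrow> real" where
  "crofton_kernel w = w - sin w - 2/3 * sin w ^ 3"

text \<open>Cubic decay at 0 is needed because small visual angles belong to far points; the two
  parts contribute 1/6 and 2/3 of \<open>w ^ 3\<close>.\<close>

lemma abs_crofton_kernel_le:
  assumes "0 \<le> w" "w \<le> pi"
  shows "\<bar>crofton_kernel w\<bar> \<le> w ^ 3"
proof -
  have "\<bar>sin w - w\<bar> \<le> w ^ 3 / 6"
    using Maclaurin_sin_bound[of w 3] assms
    by (simp add: numeral_eq_Suc sin_coeff_def lessThan_Suc fact_numeral)
  moreover have "0 \<le> sin w" "sin w \<le> w" using assms sin_ge_zero sin_x_le_x by auto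
  moreover from this have "0 \<le> sin w ^ 3" "sin w ^ 3 \<le> w ^ 3" by (auto intro: power_mono)
  ultimately show ?thesis unfolding crofton_kernel_def abs_le_iff by linarith
qed

text \<open>From sin x >= x - x^3/6 and x^2 <= 4. The range contains (pi - t)/2, where the bound is
  applied.\<close>

lemma sin_ge_third:
  assumes "0 \<le> x" "x \<le> 2"
  shows "x / 3 \<le> sin (x::real)"
proof -
  have "\<bar>sin x - x\<bar> \<le> x ^ 3 / 6"
    using Maclaurin_sin_bound[of x 3] assms
    by (simp add: numeral_eq_Suc sin_coeff_def lessThan_Suc fact_numeral)
  moreover have "x ^ 3 \<le> 4 * x"
    using mult_left_mono[OF power_mono[OF assms(2,1), of 2] assms(1)]
    by (simp add: power2_eq_square power3_eq_cube mult_ac)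
  ultimately show ?thesis by linarith
qed

text \<open>In half angles u = t/2 the weight is sin u / (2 cos^3 u), and cos u = sin (w/2) >= w/6
  for w = pi - t. Hence the constant 108 = 6^3 / 2.\<close>

lemma crofton_kernel_weight_bounded:
  assumes t: "0 < t" "t < pi"
  shows "\<bar>crofton_kernel (pi - t)\<bar> * ((1 - cos t)\<^sup>2 / sin t ^ 3) \<le> 108"
proof -
  let ?u = "t / 2" and ?w = "pi - t"
  have pos: "sin ?u > 0" "cos ?u > 0" using t by (auto intro!: sin_gt_zero cos_gt_zero_pi)
  have w: "?w > 0" using t by simp
  have "?w / 6 \<le> cos ?u"
    using sin_ge_third[of "?w / 2"] t pi_less_4 by (simp add: diff_divide_distrib sin_diff)
  then have c3: "(?w / 6) ^ 3 \<le> cos ?u ^ 3" using w by (intro power_mono) auto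
  have e: "cos t = 1 - 2 * sin ?u ^ 2" "sin t = 2 * sin ?u * cos ?u"
    using cos_double_sin[of ?u] sin_double[of ?u] by simp_all
  have "(1 - cos t)\<^sup>2 / sin t ^ 3 = sin ?u / (2 * cos ?u ^ 3)"
    using pos unfolding e by (simp add: power2_eq_square power3_eq_cube field_simps)
  also have "\<dots> \<le> 1 / (2 * (?w / 6) ^ 3)"
    using pos w c3 by (intro frac_le) auto
  finally have "\<bar>crofton_kernel ?w\<bar> * ((1 - cos t)\<^sup>2 / sin t ^ 3) \<le> ?w ^ 3 * (1 / (2 * (?w / 6) ^ 3))"
    using abs_crofton_kernel_le[of ?w] t sin_gt_zero[OF t] by (intro mult_mono) auto
  moreover have "v ^ 3 * (1 / (2 * (v / 6) ^ 3)) = 108" if "v > 0" for v :: real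
    using that by (simp add: power3_eq_cube)
  ultimately show ?thesis using w by metis
qed

text \<open>The singular factors of the two boundary terms of \<open>integral_crofton_kernel\<close>
  at t = pi, computed at 0 after w = pi - t.\<close>

lemma tendsto_crofton_kernel_left_pi:
  "((\<lambda>t. crofton_kernel (pi - t) / (sin t)\<^sup>2) \<longlongrightarrow> 0) (at_left pi)"
  "((\<lambda>t. (1 + cos t + 2 * (sin t)\<^sup>2 * cos t) / sin t) \<longlongrightarrow> 0) (at_left pi)"
proof -
  have f: "filterlim (\<lambda>t. pi - t) (at_right 0) (at_left pi)" by real_asymp
  have "((\<lambda>w. crofton_kernel w / (sin w)\<^sup>2) \<longlongrightarrow> 0) (at_right 0)"
    unfolding crofton_kernel_def by real_asymp
  from filterlim_compose[OF this f]
  show "((\<lambda>t. crofton_kernel (pi - t) / (sin t)\<^sup>2) \<longlongrightarrow> 0) (at_left pi)" by simp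
  have "((\<lambda>w. (1 - cos w - 2 * (sin w)\<^sup>2 * cos w) / sin w) \<longlongrightarrow> 0) (at_right (0::real))"
    by real_asymp
  from filterlim_compose[OF this f]
  show "((\<lambda>t. (1 + cos t + 2 * (sin t)\<^sup>2 * cos t) / sin t) \<longlongrightarrow> 0) (at_left pi)" by simp
qed

text \<open>The integrand is \<open>crofton_kernel (pi - t) * H'' t\<close> for \<open>H t = (A t - A 0 * cos t) / sin t\<close>.
  Since \<open>crofton_kernel'' w = - 3 * sin w * cos (2 * w)\<close>, integrating by parts twice cancels the
  denominator.\<close>

lemma integral_crofton_kernel:
  fixes A A' A'' :: "real \<Rightarrow> real"
  assumes A: "\<And>x. (A has_real_derivative A' x) (at x)"
    and A': "\<And>x. (A' has_real_derivative A'' x) (at x)"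
    and A'': "continuous_on UNIV A''" and A'0: "A' 0 = 0"
  shows "((\<lambda>t. crofton_kernel (pi - t) *
      ((A'' t - 2 * cos t / sin t * A' t + (1 + (cos t)\<^sup>2) / (sin t)\<^sup>2 * A t
        - 2 * A 0 * cos t / (sin t)\<^sup>2) / sin t)) has_integral
    (- pi * (A'' 0 + A 0) / 2 - 3 * integral {0..pi} (\<lambda>t. cos (2 * t) * A t))) {0..pi}"
proof -
  \<comment> \<open>\<open>?n t / (sin t)\<^sup>2\<close> is H' and \<open>?k t\<close> is the
    derivative of the kernel at \<open>pi - t\<close>. Thus \<open>?G\<close> collects the boundary
    terms of both integrations by parts, and its derivative is \<open>?J t\<close> plus
    \<open>3 * (cos (2 * t) * (A t - A 0 * cos t))\<close>.\<close>
  let ?n = "\<lambda>t. (A' t + A 0 * sin t) * sin t - (A t - A 0 * cos t) * cos t"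
  let ?H = "\<lambda>t. (A t - A 0 * cos t) / sin t"
  let ?k = "\<lambda>t. 1 + cos t + 2 * (sin t)\<^sup>2 * cos t"
  let ?G = "\<lambda>t. crofton_kernel (pi - t) * (?n t / (sin t)\<^sup>2) + ?k t * ?H t"
  \<comment> \<open>Continuous extension of \<open>?G\<close>: at 0 the kernel tends to pi and H' to
    \<open>(A'' 0 + A 0) / 2\<close>; at pi both boundary terms vanish.\<close>
  define E where "E t = (if t = 0 then pi * ((A'' 0 + A 0) / 2) else if t = pi then 0 else ?G t)" for t
  let ?J = "\<lambda>t. crofton_kernel (pi - t) *
      ((A'' t - 2 * cos t / sin t * A' t + (1 + (cos t)\<^sup>2) / (sin t)\<^sup>2 * A t
        - 2 * A 0 * cos t / (sin t)\<^sup>2) / sin t)"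
  note [continuous_intros] = DERIV_isCont[OF A] DERIV_isCont[OF A']
  have cA'': "isCont A'' t" for t using A'' by (simp add: continuous_on_eq_continuous_at)
  note A_tendsto [tendsto_intros] = DERIV_isCont[OF A, unfolded isCont_def]
    DERIV_isCont[OF A', unfolded isCont_def] cA''[unfolded isCont_def]
  have right: "(f \<longlongrightarrow> l) (at_right x)" if "(f \<longlongrightarrow> l) (at x)" for f :: "real \<Rightarrow> real" and l x
    using that by (rule tendsto_within_subset) auto
  have left: "(f \<longlongrightarrow> l) (at_left x)" if "(f \<longlongrightarrow> l) (at x)" for f :: "real \<Rightarrow> real" and l x
    using that by (rule tendsto_within_subset) auto
  have dn: "(?n has_real_derivative (A'' t + A t) * sin t) (at t)" for t
    by (rule derivative_eq_intros refl A A' | simp add: algebra_simps)+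
  have dAc: "((\<lambda>t. A t - A 0 * cos t) has_real_derivative A' t + A 0 * sin t) (at t)" for t
    by (auto intro!: derivative_eq_intros A)
  have dsin2: "((\<lambda>t. (sin t)\<^sup>2) has_real_derivative 2 * sin t * cos t) (at t)" for t :: real
    by (auto intro!: derivative_eq_intros)
  have spos: "sin t > 0" if "0 < t" "t < pi" for t using that by (rule sin_gt_zero)
  have ev: "eventually (\<lambda>t. 0 < t \<and> t < pi/2) (at_right (0::real))"
    by (auto simp: eventually_at_right_field intro!: exI[of _ "pi/2"])
  have limn: "((\<lambda>t. ?n t / (sin t)\<^sup>2) \<longlongrightarrow> (A'' 0 + A 0) / 2) (at_right 0)"
  proof (rule lhopital_right)
    show "(?n \<longlongrightarrow> 0) (at_right 0)"
      by (rule right) (auto intro!: tendsto_eq_intros)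
    show "((\<lambda>t::real. (sin t)\<^sup>2) \<longlongrightarrow> 0) (at_right 0)"
      by (rule right) (auto intro!: tendsto_eq_intros)
    show "\<forall>\<^sub>F t in at_right 0. (sin t)\<^sup>2 \<noteq> (0::real)"
      using ev by eventually_elim (use spos in force)
    show "\<forall>\<^sub>F t in at_right 0. 2 * sin t * cos t \<noteq> (0::real)"
      using ev
    proof eventually_elim
      case (elim t)
      then have "sin t > 0" "cos t > 0" by (auto intro!: spos cos_gt_zero_pi)
      then show ?case by simp
    qed
    show "\<forall>\<^sub>F t in at_right 0. (?n has_real_derivative (A'' t + A t) * sin t) (at t)"
      using dn by simp
    show "\<forall>\<^sub>F t in at_right 0. ((\<lambda>t. (sin t)\<^sup>2) has_real_derivative 2 * sin t * cos t) (at t)"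
      using dsin2 by simp
    have "((\<lambda>t. (A'' t + A t) / (2 * cos t)) \<longlongrightarrow> (A'' 0 + A 0) / 2) (at_right 0)"
      by (rule right) (auto intro!: tendsto_eq_intros)
    then show "((\<lambda>t. (A'' t + A t) * sin t / (2 * sin t * cos t)) \<longlongrightarrow> (A'' 0 + A 0) / 2) (at_right 0)"
      by (rule Lim_transform_eventually) (use ev in eventually_elim, use spos in force)
  qed
  \<comment> \<open>\<open>A' 0 = 0\<close> makes H vanish at 0, and with it the boundary term whose
    factor \<open>?k\<close> tends to 2.\<close>
  have limH: "(?H \<longlongrightarrow> 0) (at_right 0)"
  proof (rule lhopital_right)
    show "((\<lambda>t. A t - A 0 * cos t) \<longlongrightarrow> 0) (at_right 0)"
      by (rule right) (auto intro!: tendsto_eq_intros)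
    show "((\<lambda>t::real. sin t) \<longlongrightarrow> 0) (at_right 0)"
      by (rule right) (auto intro!: tendsto_eq_intros)
    show "\<forall>\<^sub>F t in at_right 0. sin t \<noteq> (0::real)"
      using ev by eventually_elim (use spos in force)
    show "\<forall>\<^sub>F t in at_right 0. cos t \<noteq> (0::real)"
      using ev
    proof eventually_elim
      case (elim t)
      then have "cos t > 0" by (auto intro!: cos_gt_zero_pi)
      then show ?case by simp
    qed
    show "\<forall>\<^sub>F t in at_right 0. ((\<lambda>t. A t - A 0 * cos t) has_real_derivative A' t + A 0 * sin t) (at t)"
      using dAc by simp
    show "\<forall>\<^sub>F t in at_right 0. (sin has_real_derivative cos t) (at t)"
      by (auto intro!: derivative_eq_intros)
    show "((\<lambda>t. (A' t + A 0 * sin t) / cos t) \<longlongrightarrow> 0) (at_right 0)"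
      by (rule right) (auto intro!: tendsto_eq_intros simp: A'0)
  qed
  have lim0: "(?G \<longlongrightarrow> pi * ((A'' 0 + A 0) / 2) + 2 * 0) (at_right 0)"
    by (intro tendsto_add tendsto_mult limn limH)
      (auto intro!: right tendsto_eq_intros simp: crofton_kernel_def)
  have limpi: "(?G \<longlongrightarrow> 0) (at_left pi)"
  proof -
    have "((\<lambda>t. crofton_kernel (pi - t) / (sin t)\<^sup>2 * ?n t + ?k t / sin t * (A t - A 0 * cos t))
        \<longlongrightarrow> 0 * ?n pi + 0 * (A pi - A 0 * cos pi)) (at_left pi)"
      by (intro tendsto_add[OF tendsto_mult tendsto_mult] tendsto_crofton_kernel_left_pi left)
        (auto intro!: tendsto_eq_intros)
    then show ?thesis by simp
  qed
  have derG: "(?G has_real_derivative ?J t + 3 * (cos (2 * t) * (A t - A 0 * cos t))) (at t)"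
    if t: "t \<in> {0<..<pi}" for t
  proof -
    have s: "sin t \<noteq> 0" using spos t by force
    have dk: "((\<lambda>t. crofton_kernel (pi - t)) has_real_derivative - ?k t) (at t)"
      unfolding crofton_kernel_def
      by (rule derivative_eq_intros refl | simp add: power2_eq_square)+
    have dk': "(?k has_real_derivative - sin t + 4 * sin t * (cos t)\<^sup>2 - 2 * sin t ^ 3) (at t)"
      by (rule derivative_eq_intros refl | simp add: power2_eq_square power3_eq_cube)+
    have dns: "((\<lambda>t. ?n t / (sin t)\<^sup>2) has_real_derivative
       ((A'' t + A t) * sin t * (sin t)\<^sup>2 - ?n t * (2 * sin t * cos t)) / (sin t ^ 4)) (at t)"
      by (rule DERIV_cong[OF DERIV_divide[OF dn dsin2]]) (use s in \<open>simp_all add: power2_eq_square numeral_eq_Suc\<close>)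
    have dH: "(?H has_real_derivative ?n t / (sin t)\<^sup>2) (at t)"
      by (rule DERIV_cong[OF DERIV_divide[OF dAc DERIV_sin]]) (use s in \<open>simp_all add: power2_eq_square\<close>)
    have D: "(?G has_real_derivative
       - ?k t * (?n t / (sin t)\<^sup>2) + ((A'' t + A t) * sin t * (sin t)\<^sup>2 - ?n t * (2 * sin t * cos t)) / (sin t ^ 4) * crofton_kernel (pi - t)
       + ((- sin t + 4 * sin t * (cos t)\<^sup>2 - 2 * sin t ^ 3) * ?H t + ?n t / (sin t)\<^sup>2 * ?k t)) (at t)"
      by (intro DERIV_add DERIV_mult dk dk' dns dH)
    have e1: "(- sin t + 4 * sin t * (cos t)\<^sup>2 - 2 * sin t ^ 3) * ?H t
        = 3 * (cos (2 * t) * (A t - A 0 * cos t))"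
    proof -
      have c2: "- 1 + 4 * (cos t)\<^sup>2 - 2 * (sin t)\<^sup>2 = 3 * cos (2 * t)"
        by (simp add: cos_double cos_squared_eq)
      then have "- sin t + 4 * sin t * (cos t)\<^sup>2 - 2 * sin t ^ 3 = sin t * (3 * cos (2 * t))"
        by (simp add: power3_eq_cube power2_eq_square algebra_simps flip: c2)
      then show ?thesis using s by simp
    qed
    have e2: "((A'' t + A t) * sin t * (sin t)\<^sup>2 - ?n t * (2 * sin t * cos t)) / (sin t ^ 4) =
       (A'' t - 2 * cos t / sin t * A' t + (1 + (cos t)\<^sup>2) / (sin t)\<^sup>2 * A t
        - 2 * A 0 * cos t / (sin t)\<^sup>2) / sin t"
    proof -
      have "((A'' t + A t) * s * s\<^sup>2 - ((A' t + A 0 * s) * s - (A t - A 0 * c) * c) * (2 * s * c)) / s ^ 4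
          = (A'' t - 2 * c / s * A' t + (1 + c\<^sup>2) / s\<^sup>2 * A t - 2 * A 0 * c / s\<^sup>2) / s"
        if "s\<^sup>2 + c\<^sup>2 = 1" "s \<noteq> 0" for s c
      proof -
        have "(A'' t + A t) * s * s\<^sup>2 - ((A' t + A 0 * s) * s - (A t - A 0 * c) * c) * (2 * s * c)
          = A'' t * s ^ 3 - 2 * c * s\<^sup>2 * A' t + ((s\<^sup>2 + c\<^sup>2) + c\<^sup>2) * s * A t - 2 * A 0 * c * s * (s\<^sup>2 + c\<^sup>2)"
          by (simp add: power2_eq_square power3_eq_cube algebra_simps)
        moreover have "(A'' t - 2 * c / s * A' t + (1 + c\<^sup>2) / s\<^sup>2 * A t - 2 * A 0 * c / s\<^sup>2) / s
          = (A'' t * s ^ 3 - 2 * c * s\<^sup>2 * A' t + (1 + c\<^sup>2) * s * A t - 2 * A 0 * c * s * 1) / s ^ 4"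
          using that(2) by (simp add: divide_simps power2_eq_square numeral_eq_Suc) (simp add: algebra_simps)
        ultimately show ?thesis using that(1) by simp
      qed
      from this[of "sin t" "cos t"] show ?thesis using s by simp
    qed
    have e3: "- k * X + Y * f + (Z + X * k) = f * Y + (Z::real)" for k X Y Z f
      by (simp add: algebra_simps)
    show ?thesis using D unfolding e1 e2 e3 .
  qed
  have evE: "eventually (\<lambda>t. ?G t = E t) (at_right 0)"
    using ev by eventually_elim (auto simp: E_def)
  have evE': "eventually (\<lambda>t. ?G t = E t) (at_left pi)"
    by (auto simp: eventually_at_left_field E_def intro!: exI[of _ 0])
  have derE: "(E has_real_derivative ?J t + 3 * (cos (2 * t) * (A t - A 0 * cos t))) (at t)"
    if t: "t \<in> {0<..<pi}" for t
    by (rule has_field_derivative_transform_within_open[OF derG[OF t], of "{0<..<pi}"])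
      (use t in \<open>auto simp: E_def\<close>)
  have "continuous_on {0..pi} E"
  proof (rule continuous_on_IccI)
    show "(E \<longlongrightarrow> E 0) (at_right 0)" using Lim_transform_eventually[OF lim0 evE] by (simp add: E_def[of 0])
    show "(E \<longlongrightarrow> E pi) (at_left pi)" using Lim_transform_eventually[OF limpi evE'] by (simp add: E_def[of pi])
    show "E \<midarrow>x\<rightarrow> E x" if "0 < x" "x < pi" for x
      using DERIV_isCont[OF derE] that by (auto simp: isCont_def)
  qed simp
  then have 1: "((\<lambda>t. ?J t + 3 * (cos (2 * t) * (A t - A 0 * cos t))) has_integral (E pi - E 0)) {0..pi}"
    using derE by (intro fundamental_theorem_of_calculus_interior)
      (auto simp flip: has_real_derivative_iff_has_vector_derivative)
  have cA: "continuous_on {0..pi} A"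
    by (auto intro!: continuous_at_imp_continuous_on DERIV_isCont[OF A])
  have 2: "((\<lambda>t. cos (2 * t) * A t) has_integral integral {0..pi} (\<lambda>t. cos (2 * t) * A t)) {0..pi}"
    by (intro integrable_integral integrable_continuous_real continuous_intros cA)
  \<comment> \<open>The subtracted \<open>A 0 * cos t\<close> contributes nothing: cos t and cos 2t
    are orthogonal on [0, pi].\<close>
  have "((\<lambda>t. cos (2 * t) * cos t) has_integral (sin pi - 2/3 * sin pi ^ 3) - (sin 0 - 2/3 * sin 0 ^ 3)) {0..pi}"
  proof (rule fundamental_theorem_of_calculus)
    have "((\<lambda>x. sin x - 2/3 * sin x ^ 3) has_real_derivative cos (2 * x) * cos x) (at x within {0..pi})" for x
      unfolding cos_double_sin
      by (rule derivative_eq_intros refl | simp add: power2_eq_square left_diff_distrib)+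
    then show "((\<lambda>x. sin x - 2/3 * sin x ^ 3) has_vector_derivative cos (2 * x) * cos x) (at x within {0..pi})" for x
      by (simp add: has_real_derivative_iff_has_vector_derivative)
  qed simp
  then have "((\<lambda>t. 3 * (cos (2 * t) * A t) - 3 * A 0 * (cos (2 * t) * cos t)) has_integral
      3 * integral {0..pi} (\<lambda>t. cos (2 * t) * A t) - 3 * A 0 * 0) {0..pi}"
    by (intro has_integral_diff has_integral_mult_right 2) simp
  from has_integral_diff[OF 1 this] show ?thesis
    by (simp add: E_def algebra_simps add_divide_distrib diff_divide_distrib)
qed

section \<open>Periodic support functions\<close>

text \<open>Convexity is kept out because the locale is interpreted again for \<open>p\<close>
  without its low harmonics, which need not be a support function.\<close>

locale periodic_C2 =
  fixes p p' p'' :: "real \<Rightarrow> real"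
  assumes p: "\<And>x. (p has_real_derivative p' x) (at x)"
    and p': "\<And>x. (p' has_real_derivative p'' x) (at x)"
    and cont: "continuous_on UNIV p''"
    and per: "\<And>x. p (x + 2*pi) = p x"
begin

lemma per': "p' (x + 2*pi) = p' x"
proof -
  have "((\<lambda>x. p (x + 2*pi)) has_real_derivative p' (x + 2*pi)) (at x)"
    using p[of "x + 2*pi"] by (simp add: DERIV_shift)
  then show ?thesis using p DERIV_unique unfolding per by blast
qed

lemma per'': "p'' (x + 2*pi) = p'' x"
proof -
  have "((\<lambda>x. p' (x + 2*pi)) has_real_derivative p'' (x + 2*pi)) (at x)"
    using p'[of "x + 2*pi"] by (simp add: DERIV_shift)
  then show ?thesis using p' DERIV_unique unfolding per' by blast
qed

lemma continuous_p [continuous_intros]: "continuous_on S f \<Longrightarrow> continuous_on S (\<lambda>x. p (f x))"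
  using continuous_on_compose2[of UNIV p S f] DERIV_isCont[OF p] by (auto simp: continuous_on_eq_continuous_at)

lemma continuous_p' [continuous_intros]: "continuous_on S f \<Longrightarrow> continuous_on S (\<lambda>x. p' (f x))"
  using continuous_on_compose2[of UNIV p' S f] DERIV_isCont[OF p'] by (auto simp: continuous_on_eq_continuous_at)

lemma continuous_p'' [continuous_intros]: "continuous_on S f \<Longrightarrow> continuous_on S (\<lambda>x. p'' (f x))"
  using continuous_on_compose2[OF cont] by auto

section \<open>Autocorrelation of \<open>p\<close> and the integral over x of the product of the
  tangent lengths\<close>

definition autocorr :: "real \<Rightarrow> real" where
  "autocorr t = integral {0..2*pi} (\<lambda>x. p x * p (x + t))"
definition autocorr' :: "real \<Rightarrow> real" where
  "autocorr' t = integral {0..2*pi} (\<lambda>x. p x * p' (x + t))"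
definition autocorr'' :: "real \<Rightarrow> real" where
  "autocorr'' t = integral {0..2*pi} (\<lambda>x. p x * p'' (x + t))"

lemma autocorr_deriv: "(autocorr has_real_derivative autocorr' t) (at t)"
proof -
  have "((\<lambda>t. integral (cbox 0 (2*pi)) (\<lambda>x. p x * p (x + t))) has_field_derivative
      integral (cbox 0 (2*pi)) (\<lambda>x. p x * p' (x + t))) (at t within UNIV)"
    by (rule leibniz_rule_field_derivative)
      (auto intro!: derivative_eq_intros DERIV_chain'[OF _ p] integrable_continuous_real continuous_intros
        simp: case_prod_beta)
  then show ?thesis by (simp add: autocorr_def[abs_def] autocorr'_def)
qed

lemma autocorr'_deriv: "(autocorr' has_real_derivative autocorr'' t) (at t)"
proof -
  have "((\<lambda>t. integral (cbox 0 (2*pi)) (\<lambda>x. p x * p' (x + t))) has_field_derivative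
      integral (cbox 0 (2*pi)) (\<lambda>x. p x * p'' (x + t))) (at t within UNIV)"
    by (rule leibniz_rule_field_derivative)
      (auto intro!: derivative_eq_intros DERIV_chain'[OF _ p'] integrable_continuous_real continuous_intros
        simp: case_prod_beta)
  then show ?thesis by (simp add: autocorr'_def[abs_def] autocorr''_def)
qed

lemma continuous_autocorr'': "continuous_on UNIV autocorr''"
proof -
  have "continuous_on UNIV (\<lambda>t. integral (cbox 0 (2*pi)) (\<lambda>x. p x * p'' (x + t)))"
    by (rule integral_continuous_on_param) (auto intro!: continuous_intros simp: case_prod_beta)
  then show ?thesis by (simp add: autocorr''_def[abs_def])
qed

lemma p_shift: "((\<lambda>x. p (x + t)) has_real_derivative p' (x + t)) (at x)"
  using p[of "x + t"] by (simp add: DERIV_shift)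

lemma p'_shift: "((\<lambda>x. p' (x + t)) has_real_derivative p'' (x + t)) (at x)"
  using p'[of "x + t"] by (simp add: DERIV_shift)

lemma per0: "p (2*pi + t) = p t" "p' (2*pi + t) = p' t" "p'' (2*pi + t) = p'' t"
  "p (2*pi) = p 0" "p' (2*pi) = p' 0"
  using per[of t] per'[of t] per''[of t] per[of 0] per'[of 0] by (simp_all add: add.commute)

lemma integral_p'_p: "integral {0..2*pi} (\<lambda>x. p' x * p (x + t)) = - autocorr' t"
  unfolding autocorr'_def
  by (rule integral_by_parts_periodic[OF p p_shift]) (auto intro!: continuous_intros simp: per0)

lemma integral_p'_p': "integral {0..2*pi} (\<lambda>x. p' x * p' (x + t)) = - autocorr'' t"
  unfolding autocorr''_def
  by (rule integral_by_parts_periodic[OF p p'_shift]) (auto intro!: continuous_intros simp: per0)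

lemma autocorr'_0: "autocorr' 0 = 0"
  using integral_p'_p[of 0] by (simp add: autocorr'_def mult.commute)

lemma autocorr_0: "autocorr 0 = integral {0..2*pi} (\<lambda>x. (p x)\<^sup>2)"
  by (simp add: autocorr_def power2_eq_square)

lemma autocorr''_0: "autocorr'' 0 = - integral {0..2*pi} (\<lambda>x. (p' x)\<^sup>2)"
  using integral_p'_p'[of 0] by (simp add: power2_eq_square)

lemma integral_p_p'_shift:
  assumes "0 \<le> t" "t \<le> 2*pi"
  shows "integral {0..2*pi} (\<lambda>x. p (x + t) * p' (x + t)) = 0"
    "integral {0..2*pi} (\<lambda>x. (p (x + t))\<^sup>2) = autocorr 0"
proof -
  have "integral {0..2*pi} (\<lambda>x. p (x + t) * p' (x + t)) = integral {0..2*pi} (\<lambda>x. p x * p' x)"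
    using assms by (intro integral_periodic_shift[of "\<lambda>x. p x * p' x"]) (auto intro!: continuous_intros simp: per per')
  also have "\<dots> = 0" using autocorr'_0 by (simp add: autocorr'_def)
  finally show "integral {0..2*pi} (\<lambda>x. p (x + t) * p' (x + t)) = 0" .
  show "integral {0..2*pi} (\<lambda>x. (p (x + t))\<^sup>2) = autocorr 0"
    unfolding autocorr_0
    using assms by (intro integral_periodic_shift[of "\<lambda>x. (p x)\<^sup>2"]) (auto intro!: continuous_intros simp: per)
qed

text \<open>For the support function \<open>p\<close>, these are the lengths of the tangent segments from the intersection of the
  support lines with normals at angles \<open>x\<close> and \<open>x + t\<close>.\<close>

definition tangent1 :: "real \<Rightarrow> real \<Rightarrow> real" where
  "tangent1 x t = (p (x + t) - p x * cos t) / sin t - p' x"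
definition tangent2 :: "real \<Rightarrow> real \<Rightarrow> real" where
  "tangent2 x t = (p x - p (x + t) * cos t) / sin t + p' (x + t)"

text \<open>The product expands into eight terms: two squares give \<open>autocorr 0\<close>, two
  are derivatives of squares and integrate to 0, the others become autocorrelations after moving
  derivatives onto the shifted factor.\<close>

lemma integral_tangents:
  assumes t: "0 < t" "t < pi"
  shows "((\<lambda>x. tangent1 x t * tangent2 x t) has_integral
    (autocorr'' t - 2 * cos t / sin t * autocorr' t + (1 + (cos t)\<^sup>2) / (sin t)\<^sup>2 * autocorr t
        - 2 * autocorr 0 * cos t / (sin t)\<^sup>2)) {0..2*pi}"
proof -
  let ?I = "\<lambda>f :: real \<Rightarrow> real. integral {0..2*pi} f"
  let ?s = "sin t" and ?c = "cos t"
  have s: "?s \<noteq> 0" using sin_gt_zero t by force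
  have hi: "(f has_integral ?I f) {0..2*pi}" if "continuous_on {0..2*pi} f" for f :: "real \<Rightarrow> real"
    using that by (intro integrable_integral integrable_continuous_real)
  have eq: "tangent1 x t * tangent2 x t =
      (1 + ?c\<^sup>2) / ?s\<^sup>2 * (p x * p (x + t)) - ?c / ?s\<^sup>2 * (p (x + t))\<^sup>2 - ?c / ?s\<^sup>2 * (p x)\<^sup>2
      + 1 / ?s * (p (x + t) * p' (x + t)) - ?c / ?s * (p x * p' (x + t))
      - 1 / ?s * (p x * p' x) + ?c / ?s * (p' x * p (x + t)) - p' x * p' (x + t)" for x
    unfolding tangent1_def tangent2_def using s
    by (simp add: power2_eq_square divide_simps) (simp add: algebra_simps)
  have "((\<lambda>x. tangent1 x t * tangent2 x t) has_integral
    ((1 + ?c\<^sup>2) / ?s\<^sup>2 * autocorr t - ?c / ?s\<^sup>2 * ?I (\<lambda>x. (p (x + t))\<^sup>2) - ?c / ?s\<^sup>2 * ?I (\<lambda>x. (p x)\<^sup>2)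
      + 1 / ?s * ?I (\<lambda>x. p (x + t) * p' (x + t)) - ?c / ?s * autocorr' t
      - 1 / ?s * ?I (\<lambda>x. p x * p' x) + ?c / ?s * ?I (\<lambda>x. p' x * p (x + t))
      - ?I (\<lambda>x. p' x * p' (x + t)))) {0..2*pi}"
    unfolding eq autocorr_def autocorr'_def
    by (intro has_integral_add has_integral_diff has_integral_mult_right hi continuous_intros)
  moreover have "?I (\<lambda>x. p x * p' x) = 0" using autocorr'_0 by (simp add: autocorr'_def)
  moreover have "?I (\<lambda>x. p (x + t) * p' (x + t)) = 0" "?I (\<lambda>x. (p (x + t))\<^sup>2) = autocorr 0"
    using integral_p_p'_shift[of t] t by auto
  ultimately show ?thesis
    unfolding integral_p'_p integral_p'_p' autocorr_0[symmetric]
    by (simp add: algebra_simps add_divide_distrib)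
qed

text \<open>Shifting x by t moves the lag to the other factor, so the autocorrelation is even modulo
  its period. This relates the integrals over [0, pi] and [pi, 2 pi].\<close>

lemma autocorr_reflect:
  assumes "0 \<le> t" "t \<le> 2*pi"
  shows "autocorr (2*pi - t) = autocorr t"
proof -
  have "integral {0..2*pi} (\<lambda>x. p (x + t) * p (x + t + (2*pi - t))) =
      integral {0..2*pi} (\<lambda>x. p x * p (x + (2*pi - t)))"
  proof (rule integral_periodic_shift[of "\<lambda>x. p x * p (x + (2*pi - t))"])
    show "p (x + 2*pi) * p (x + 2*pi + (2*pi - t)) = p x * p (x + (2*pi - t))" for x
      using per[of x] per[of "x + (2*pi - t)"] by (simp add: algebra_simps)
  qed (use assms in \<open>auto intro!: continuous_intros\<close>)
  moreover have "p (x + t) * p (x + t + (2*pi - t)) = p x * p (x + t)" for x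
  proof -
    have "x + t + (2*pi - t) = x + 2*pi" by simp
    then have "p (x + t + (2*pi - t)) = p x" using per[of x] by (simp only:)
    then show ?thesis by (simp only: mult.commute)
  qed
  ultimately show ?thesis by (simp only: autocorr_def)
qed

text \<open>A Fourier coefficient of an autocorrelation is the squared modulus of the coefficient of
  the function; the division by 2 comes from integrating over half a period.\<close>

lemma integral_cos2_autocorr:
  "integral {0..pi} (\<lambda>t. cos (2 * t) * autocorr t) =
    ((integral {0..2*pi} (\<lambda>x. p x * cos (2 * x)))\<^sup>2 + (integral {0..2*pi} (\<lambda>x. p x * sin (2 * x)))\<^sup>2) / 2"
proof -
  let ?I = "\<lambda>f :: real \<Rightarrow> real. integral {0..2*pi} f"
  let ?C = "?I (\<lambda>x. p x * cos (2 * x))" and ?S = "?I (\<lambda>x. p x * sin (2 * x))"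
  let ?f = "\<lambda>t. cos (2 * t) * autocorr t"
  have cA: "continuous_on S autocorr" for S
    by (auto intro!: continuous_at_imp_continuous_on DERIV_isCont[OF autocorr_deriv])
  have i: "?f integrable_on {a..b}" for a b
    by (auto intro!: integrable_continuous_real continuous_intros cA)
  have "integral {pi..2*pi} ?f = integral {pi..2*pi} (\<lambda>t. ?f (2*pi - t))"
    by (rule integral_cong) (simp add: autocorr_reflect cos_diff)
  also have "\<dots> = integral {-(2*pi)..-pi} (\<lambda>t. ?f (2*pi + t))"
    using Henstock_Kurzweil_Integration.integral_reflect_real[of "2*pi" pi "\<lambda>t. ?f (2*pi - t)"] by simp
  also have "\<dots> = integral {0..pi} ?f"
    using integral_shift_real_ivl[of 0 "2*pi" pi ?f] by (simp add: add.commute)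
  finally have half: "?I ?f = 2 * integral {0..pi} ?f"
    using Henstock_Kurzweil_Integration.integral_combine[of 0 pi "2*pi" ?f] i by simp
  \<comment> \<open>For fixed x, the lag is replaced by the absolute angle; the addition formula for
    the cosine then separates the two variables.\<close>
  have inner: "?I (\<lambda>t. cos (2 * t) * (p x * p (x + t))) = p x * (cos (2 * x) * ?C + sin (2 * x) * ?S)"
    if x: "x \<in> {0..2*pi}" for x
  proof -
    have "?I (\<lambda>t. cos (2 * (t + x - x)) * p (t + x)) = ?I (\<lambda>t. cos (2 * (t - x)) * p t)"
    proof (rule integral_periodic_shift[of "\<lambda>t. cos (2 * (t - x)) * p t"])
      show "cos (2 * (t + 2*pi - x)) * p (t + 2*pi) = cos (2 * (t - x)) * p t" for t
      proof -
        have "cos (2 * (t + 2*pi - x)) = cos (2 * (t - x))"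
          using cos_periodic[of "2 * (t - x) + 2*pi"] cos_periodic[of "2 * (t - x)"]
          by (simp add: algebra_simps)
        then show ?thesis by (simp only: per)
      qed
    qed (use x in \<open>auto intro!: continuous_intros\<close>)
    also have "\<dots> = ?I (\<lambda>t. cos (2 * x) * (p t * cos (2 * t)) + sin (2 * x) * (p t * sin (2 * t)))"
      by (simp add: right_diff_distrib cos_diff algebra_simps)
    also have "\<dots> = cos (2 * x) * ?C + sin (2 * x) * ?S"
      by (subst integral_add) (auto intro!: integrable_continuous_real continuous_intros)
    finally have "?I (\<lambda>t. cos (2 * t) * p (t + x)) = cos (2 * x) * ?C + sin (2 * x) * ?S" by simp
    then have "p x * ?I (\<lambda>t. cos (2 * t) * p (t + x)) = p x * (cos (2 * x) * ?C + sin (2 * x) * ?S)" by simp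
    then show ?thesis
      unfolding integral_mult_right[symmetric] by (simp add: add.commute mult_ac)
  qed
  have "continuous_on (cbox (0, 0) (2*pi, 2*pi)) (\<lambda>(t, x). cos (2 * t) * (p x * p (x + t)))"
    unfolding case_prod_beta by (intro continuous_intros)
  note swap = integral_swap_continuous[OF this]
  have "?I ?f = ?I (\<lambda>t. ?I (\<lambda>x. cos (2 * t) * (p x * p (x + t))))"
    by (simp add: autocorr_def)
  also have "\<dots> = ?I (\<lambda>x. ?I (\<lambda>t. cos (2 * t) * (p x * p (x + t))))"
    using swap by simp
  also have "\<dots> = ?I (\<lambda>x. p x * (cos (2 * x) * ?C + sin (2 * x) * ?S))"
    by (rule integral_cong) (use inner in auto)
  also have "\<dots> = ?I (\<lambda>x. ?C * (p x * cos (2 * x)) + ?S * (p x * sin (2 * x)))"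
    by (rule integral_cong) (simp add: algebra_simps)
  also have "\<dots> = ?C * ?C + ?S * ?S"
    by (subst integral_add) (auto intro!: integrable_continuous_real continuous_intros)
  finally show ?thesis using half by (simp add: power2_eq_square)
qed

theorem integral_crofton_tangents:
  "((\<lambda>t. integral {0..2*pi} (\<lambda>x. crofton_kernel (pi - t) * (tangent1 x t * tangent2 x t / sin t))) has_integral
    (- pi / 2 * (integral {0..2*pi} (\<lambda>x. (p x)\<^sup>2) - integral {0..2*pi} (\<lambda>x. (p' x)\<^sup>2))
     - 3/2 * ((integral {0..2*pi} (\<lambda>x. p x * cos (2 * x)))\<^sup>2 + (integral {0..2*pi} (\<lambda>x. p x * sin (2 * x)))\<^sup>2)))
   {0..pi}"
\<comment> \<open>The evaluation of the inner integral needs sin t nonzero, so it is used only on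
  the open interval.\<close>
proof (rule has_integral_spike_interior[of _ _ 0 pi, simplified box_real cbox_interval])
  let ?Q = "\<lambda>t. autocorr'' t - 2 * cos t / sin t * autocorr' t + (1 + (cos t)\<^sup>2) / (sin t)\<^sup>2 * autocorr t
        - 2 * autocorr 0 * cos t / (sin t)\<^sup>2"
  show "((\<lambda>t. crofton_kernel (pi - t) * (?Q t / sin t)) has_integral
    (- pi / 2 * (integral {0..2*pi} (\<lambda>x. (p x)\<^sup>2) - integral {0..2*pi} (\<lambda>x. (p' x)\<^sup>2))
     - 3/2 * ((integral {0..2*pi} (\<lambda>x. p x * cos (2 * x)))\<^sup>2 + (integral {0..2*pi} (\<lambda>x. p x * sin (2 * x)))\<^sup>2)))
   {0..pi}"
    using integral_crofton_kernel[OF autocorr_deriv autocorr'_deriv continuous_autocorr'' autocorr'_0]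
    unfolding integral_cos2_autocorr autocorr''_0 by (simp add: autocorr_0 algebra_simps add_divide_distrib diff_divide_distrib)
  show "integral {0..2*pi} (\<lambda>x. crofton_kernel (pi - t) * (tangent1 x t * tangent2 x t / sin t)) =
      crofton_kernel (pi - t) * (?Q t / sin t)" if "t \<in> {0<..<pi}" for t
    using integral_unique[OF integral_tangents[of t]] that by simp
qed

end

locale convex_support = periodic_C2 +
  assumes pos: "\<And>x. p x + p'' x > 0"
begin

text \<open>This is \<open>sturm_comparison\<close> from x to x + t divided by sin t;
  \<open>tangent2_pos\<close> is the same comparison run backwards.\<close>

lemma tangent1_pos:
  assumes "0 < t" "t < pi"
  shows "tangent1 x t > 0"
  using sturm_comparison[OF p p' pos, of x "x + t"] assms sin_gt_zero[of t]
  by (simp add: tangent1_def field_simps)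

lemma tangent2_pos:
  assumes "0 < t" "t < pi"
  shows "tangent2 x t > 0"
  using sturm_comparison[OF p p' pos, of "x + t" x] assms sin_gt_zero[of t]
  by (simp add: tangent2_def field_simps)

end

context convex_support
begin

text \<open>The difference \<open>M - p\<close> is again a convex support function for a large constant \<open>M\<close>, so its
  tangent lengths are positive as well.\<close>

lemma tangents_le:
  obtains M where "M > 0" "\<And>x t. 0 < t \<Longrightarrow> t < pi \<Longrightarrow> tangent1 x t \<le> M * ((1 - cos t) / sin t)"
    "\<And>x t. 0 < t \<Longrightarrow> t < pi \<Longrightarrow> tangent2 x t \<le> M * ((1 - cos t) / sin t)"
proof -
  have "compact ((\<lambda>x. p x + p'' x) ` {0..2*pi})"
    by (intro compact_continuous_image continuous_intros) auto
  then obtain B where B: "\<And>x. x \<in> {0..2*pi} \<Longrightarrow> \<bar>p x + p'' x\<bar> \<le> B"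
    by (force dest!: compact_imp_bounded simp: bounded_iff)
  have "p x + p'' x \<le> B" for x
  proof -
    define k where "k = \<lfloor>x / (2*pi)\<rfloor>"
    define y where "y = x - 2*pi * of_int k"
    have "of_int k \<le> x / (2*pi)" "x / (2*pi) < of_int k + 1" unfolding k_def by linarith+
    then have "y \<in> {0..2*pi}" by (auto simp: y_def field_simps)
    moreover have "p x = p y" "p'' x = p'' y"
      using periodic_of_int[of p y k] periodic_of_int[of p'' y k] by (auto simp: per per'' y_def)
    ultimately show ?thesis using B[of y] by auto
  qed
  then have M: "(B + 1 - p x) + (- p'' x) > 0" for x by (smt (verit))
  interpret q: convex_support "\<lambda>x. B + 1 - p x" "\<lambda>x. - p' x" "\<lambda>x. - p'' x"
    using M per by unfold_locales (auto intro!: derivative_eq_intros p p' continuous_intros)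
  have s: "sin t > 0" if "0 < t" "t < pi" for t using that by (rule sin_gt_zero)
  have "tangent1 x t \<le> (B + 1) * ((1 - cos t) / sin t)" if "0 < t" "t < pi" for x t
  proof -
    \<comment> \<open>Tangent lengths are linear in the support function, and a circle of radius
      \<open>B + 1\<close> has tangent length
      \<open>(B + 1) * ((1 - cos t) / sin t)\<close>.\<close>
    have "q.tangent1 x t = (B + 1) * ((1 - cos t) / sin t) - tangent1 x t"
      unfolding q.tangent1_def tangent1_def
      by (simp add: diff_divide_distrib add_divide_distrib algebra_simps)
    then show ?thesis using q.tangent1_pos[OF that, of x] by simp
  qed
  moreover have "tangent2 x t \<le> (B + 1) * ((1 - cos t) / sin t)" if "0 < t" "t < pi" for x t
  proof -
    have "q.tangent2 x t = (B + 1) * ((1 - cos t) / sin t) - tangent2 x t"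
      unfolding q.tangent2_def tangent2_def
      by (simp add: diff_divide_distrib add_divide_distrib algebra_simps)
    then show ?thesis using q.tangent2_pos[OF that, of x] by simp
  qed
  moreover have "B + 1 > 0" using M[of 0] pos[of 0] by linarith
  ultimately show thesis using that by blast
qed

text \<open>The bounds of \<open>tangents_le\<close> turn the Jacobian into a multiple of the weight
  in \<open>crofton_kernel_weight_bounded\<close>.\<close>

lemma crofton_tangents_bounded:
  obtains B where "\<And>x t. 0 < t \<Longrightarrow> t < pi \<Longrightarrow>
    \<bar>crofton_kernel (pi - t) * (tangent1 x t * tangent2 x t / sin t)\<bar> \<le> B"
proof -
  obtain M where M: "M > 0" "\<And>x t. 0 < t \<Longrightarrow> t < pi \<Longrightarrow> tangent1 x t \<le> M * ((1 - cos t) / sin t)"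
    "\<And>x t. 0 < t \<Longrightarrow> t < pi \<Longrightarrow> tangent2 x t \<le> M * ((1 - cos t) / sin t)"
    using tangents_le by blast
  have "\<bar>crofton_kernel (pi - t) * (tangent1 x t * tangent2 x t / sin t)\<bar> \<le> M\<^sup>2 * 108"
    if t: "0 < t" "t < pi" for x t
  proof -
    have s: "sin t > 0" using t by (rule sin_gt_zero)
    have "tangent1 x t * tangent2 x t \<le> (M * ((1 - cos t) / sin t)) * (M * ((1 - cos t) / sin t))"
      using M t tangent1_pos[OF t, of x] tangent2_pos[OF t, of x] s by (intro mult_mono) auto
    then have "tangent1 x t * tangent2 x t / sin t \<le> M\<^sup>2 * ((1 - cos t)\<^sup>2 / sin t ^ 3)"
      using s by (simp add: power2_eq_square power3_eq_cube field_simps)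
    then have "\<bar>crofton_kernel (pi - t)\<bar> * (tangent1 x t * tangent2 x t / sin t)
        \<le> \<bar>crofton_kernel (pi - t)\<bar> * (M\<^sup>2 * ((1 - cos t)\<^sup>2 / sin t ^ 3))"
      by (intro mult_left_mono) auto
    also have "\<dots> = M\<^sup>2 * (\<bar>crofton_kernel (pi - t)\<bar> * ((1 - cos t)\<^sup>2 / sin t ^ 3))" by simp
    also have "\<dots> \<le> M\<^sup>2 * 108"
      using crofton_kernel_weight_bounded[OF t] by (intro mult_left_mono) auto
    finally show ?thesis
      using s tangent1_pos[OF t, of x] tangent2_pos[OF t, of x] by (simp add: abs_mult)
  qed
  then show thesis using that by blast
qed

end

section \<open>Fubini on rectangles in the plane\<close>

lemma vector_2_eq: "vector [x, y] = x *\<^sub>R axis 1 1 + y *\<^sub>R (axis 2 1 :: real^2)"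
  by (simp add: vec_eq_iff forall_2 axis_def)

lemma continuous_vector_2: "continuous_on UNIV (\<lambda>(x, y). vector [x, y] :: real^2)"
  unfolding case_prod_beta vector_2_eq by (intro continuous_intros)

text \<open>Carries Fubini from pairs of reals to \<open>real^2\<close>; it suffices to compare the
  two measures on boxes.\<close>

lemma lborel_real_2: "distr (lborel \<Otimes>\<^sub>M lborel) borel (\<lambda>(x, y). vector [x, y] :: real^2) = lborel"
proof (rule lborel_eqI[symmetric])
  have m: "(\<lambda>(x, y). vector [x, y] :: real^2) \<in> (lborel \<Otimes>\<^sub>M lborel) \<rightarrow>\<^sub>M borel"
    unfolding lborel_prod using borel_measurable_continuous_onI[OF continuous_vector_2] by simp
  fix l u :: "real^2" assume le: "\<And>b. b \<in> Basis \<Longrightarrow> l \<bullet> b \<le> u \<bullet> b"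
  have B: "Basis = {axis 1 1, axis 2 1 :: real^2}"
    by (auto simp: Basis_vec_def UNIV_2)
  have ne: "axis 1 1 \<noteq> (axis 2 1 :: real^2)" by (simp add: axis_eq_axis)
  have lu: "l $ 1 \<le> u $ 1" "l $ 2 \<le> u $ 2"
    using le[of "axis 1 1"] le[of "axis 2 1"] by (auto simp: B inner_axis)
  have v: "(\<lambda>(x, y). vector [x, y]) -` box l u \<inter> space (lborel \<Otimes>\<^sub>M lborel) = {l$1<..<u$1} \<times> {l$2<..<u$2}"
    by (auto simp: mem_box_cart forall_2 space_pair_measure)
  have "emeasure (distr (lborel \<Otimes>\<^sub>M lborel) borel (\<lambda>(x, y). vector [x, y])) (box l u)
      = emeasure (lborel \<Otimes>\<^sub>M lborel) ({l$1<..<u$1} \<times> {l$2<..<u$2})"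
    using m by (subst emeasure_distr) (auto simp only: v box_borel)
  also have "\<dots> = ennreal (u$1 - l$1) * ennreal (u$2 - l$2)"
    using lu by (subst lborel.emeasure_pair_measure_Times) auto
  also have "\<dots> = ennreal (\<Prod>b\<in>Basis. (u - l) \<bullet> b)"
    using lu ne by (simp add: B inner_axis ennreal_mult')
  finally show "emeasure (distr (lborel \<Otimes>\<^sub>M lborel) borel (\<lambda>(x, y). vector [x, y])) (box l u)
      = ennreal (\<Prod>b\<in>Basis. (u - l) \<bullet> b)" .
qed simp

text \<open>General Borel sides admit half-open and open intervals, so the integrand may be singular
  or discontinuous on the missing edges; boundedness replaces compactness.\<close>

lemma integral_rectangle_real_2:
  fixes G :: "real \<Rightarrow> real \<Rightarrow> real"
  assumes X: "X \<in> sets borel" "bounded X" and Y: "Y \<in> sets borel" "bounded Y"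
    and G: "continuous_on (X \<times> Y) (\<lambda>(x, y). G x y)"
    and B: "\<And>x y. x \<in> X \<Longrightarrow> y \<in> Y \<Longrightarrow> \<bar>G x y\<bar> \<le> B"
  defines "S \<equiv> {v :: real^2. v $ 1 \<in> X \<and> v $ 2 \<in> Y}"
  shows "(\<lambda>v. G (v $ 1) (v $ 2)) absolutely_integrable_on S"
    and "integral S (\<lambda>v. G (v $ 1) (v $ 2)) = integral Y (\<lambda>y. integral X (\<lambda>x. G x y))"
proof -
  let ?g = "\<lambda>(x, y). indicator (X \<times> Y) (x, y) *\<^sub>R G x y"
  let ?h = "\<lambda>v :: real^2. indicator S v *\<^sub>R G (v $ 1) (v $ 2)"
  let ?V = "\<lambda>(x, y). vector [x, y] :: real^2"
  have XY: "X \<times> Y \<in> sets borel" using X Y by (simp add: borel_Times)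
  have gm: "?g \<in> borel_measurable borel"
    using borel_measurable_continuous_on_indicator[OF XY G] by (simp add: case_prod_beta')
  have gi: "integrable (lborel \<Otimes>\<^sub>M lborel) ?g"
    unfolding lborel_prod
  proof (rule integrableI_bounded_set)
    show "X \<times> Y \<in> sets lborel" using XY by simp
    show "?g \<in> borel_measurable lborel" using gm by simp
    show "emeasure lborel (X \<times> Y) < \<infinity>" using X Y by (intro emeasure_bounded_finite bounded_Times)
    show "AE x in lborel. x \<in> X \<times> Y \<longrightarrow> norm (?g x) \<le> B" using B by auto
    show "AE x in lborel. x \<notin> X \<times> Y \<longrightarrow> ?g x = 0"
      by (rule AE_I2) (simp add: case_prod_beta')
  qed
  have Vm: "?V \<in> (lborel \<Otimes>\<^sub>M lborel) \<rightarrow>\<^sub>M borel"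
    unfolding lborel_prod using borel_measurable_continuous_onI[OF continuous_vector_2] by simp
  have Wm: "(\<lambda>v :: real^2. (v $ 1, v $ 2)) \<in> borel \<rightarrow>\<^sub>M borel"
    by (intro borel_measurable_continuous_onI continuous_intros)
  have h_eq: "?h = (\<lambda>v. ?g (v $ 1, v $ 2))"
    by (auto simp: S_def indicator_def)
  have hm: "?h \<in> borel_measurable borel"
    unfolding h_eq using measurable_compose[OF Wm gm] by simp
  have hV: "(\<lambda>z. ?h (?V z)) = ?g"
    by (auto simp: S_def indicator_def)
  have hi: "integrable lborel ?h"
    using gi integrable_distr_eq[OF Vm hm] by (simp only: hV lborel_real_2)
  then have "integrable lebesgue ?h"
    using hm by (subst integrable_completion) simp_all
  then show ai: "(\<lambda>v. G (v $ 1) (v $ 2)) absolutely_integrable_on S"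
    by (simp add: set_integrable_def)
  have inner: "set_integrable lborel X (\<lambda>x. G x y)" if y: "y \<in> Y" for y
    unfolding set_integrable_def
  proof (rule integrableI_bounded_set)
    show "X \<in> sets lborel" using X by simp
    have "continuous_on X (\<lambda>x. (\<lambda>(x, y). G x y) (x, y))"
      by (rule continuous_on_compose2[OF G]) (use y in \<open>auto intro!: continuous_intros\<close>)
    then show "(\<lambda>x. indicator X x *\<^sub>R G x y) \<in> borel_measurable lborel"
      using borel_measurable_continuous_on_indicator[OF X(1), of "\<lambda>x. G x y"] by simp
    show "emeasure lborel X < \<infinity>" using X by (intro emeasure_bounded_finite)
    show "AE x in lborel. x \<in> X \<longrightarrow> norm (indicator X x *\<^sub>R G x y) \<le> B" using B y by auto
  qed auto
  have outer: "(\<integral>x. ?g (x, y) \<partial>lborel) = indicator Y y *\<^sub>R integral X (\<lambda>x. G x y)" for y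
  proof (cases "y \<in> Y")
    case True
    then show ?thesis
      using set_borel_integral_eq_integral(2)[OF inner[OF True]]
      by (simp add: set_lebesgue_integral_def indicator_times)
  qed (simp add: indicator_times)
  have oi: "set_integrable lborel Y (\<lambda>y. integral X (\<lambda>x. G x y))"
    using lborel_pair.integrable_snd[of "\<lambda>x y. ?g (x, y)"] gi
    unfolding set_integrable_def outer[symmetric] by (simp add: case_prod_beta')
  have "integral S (\<lambda>v. G (v $ 1) (v $ 2)) = integral\<^sup>L lebesgue ?h"
    using set_lebesgue_integral_eq_integral(2)[OF ai] by (simp add: set_lebesgue_integral_def)
  also have "\<dots> = integral\<^sup>L lborel ?h" using hm by (subst integral_completion) simp_all
  also have "\<dots> = integral\<^sup>L (lborel \<Otimes>\<^sub>M lborel) ?g"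
    using integral_distr[OF Vm hm] by (simp only: hV lborel_real_2)
  also have "\<dots> = (\<integral>y. (\<integral>x. ?g (x, y) \<partial>lborel) \<partial>lborel)"
    using lborel_pair.integral_snd[of "\<lambda>x y. ?g (x, y)"] gi by (simp add: case_prod_beta')
  also have "\<dots> = integral Y (\<lambda>y. integral X (\<lambda>x. G x y))"
    using set_borel_integral_eq_integral(2)[OF oi] unfolding outer by (simp add: set_lebesgue_integral_def)
  finally show "integral S (\<lambda>v. G (v $ 1) (v $ 2)) = integral Y (\<lambda>y. integral X (\<lambda>x. G x y))" .
qed

section \<open>Tangent lines and the visual angle\<close>

lemma dir_components [simp]:
  "dir x $ 1 = cos x" "dir x $ 2 = sin x" "dir' x $ 1 = - sin x" "dir' x $ 2 = cos x"
  by (simp_all add: dir_def dir'_def)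

lemma inner_dir:
  "v \<bullet> dir x = v $ 1 * cos x + v $ 2 * sin x" "v \<bullet> dir' x = v $ 2 * cos x - v $ 1 * sin x"
  by (simp_all add: inner_vec_def sum_2)

lemma dir_periodic: "dir (x + 2*pi) = dir x" "dir' (x + 2*pi) = dir' x"
  by (simp_all add: dir_def dir'_def)

lemma dir_expansion: "v = (v \<bullet> dir x) *\<^sub>R dir x + (v \<bullet> dir' x) *\<^sub>R dir' x"
proof -
  have "a = (a * c + b * s) * c - (b * c - a * s) * s" "b = (a * c + b * s) * s + (b * c - a * s) * c"
    if "s\<^sup>2 + c\<^sup>2 = 1" for a b c s :: real
  proof -
    have "(a * c + b * s) * c - (b * c - a * s) * s = a * (s\<^sup>2 + c\<^sup>2)"
      "(a * c + b * s) * s + (b * c - a * s) * c = b * (s\<^sup>2 + c\<^sup>2)"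
      by (simp_all add: power2_eq_square algebra_simps)
    then show "a = (a * c + b * s) * c - (b * c - a * s) * s" "b = (a * c + b * s) * s + (b * c - a * s) * c"
      using that by simp_all
  qed
  from this[of "sin x" "cos x"] show ?thesis
    by (simp add: vec_eq_iff forall_2 inner_dir)
qed

lemma dir_orthonormal:
  "dir x \<bullet> dir x = 1" "dir' x \<bullet> dir' x = 1" "dir x \<bullet> dir' x = 0" "dir' x \<bullet> dir x = 0"
  by (simp_all add: inner_vec_def sum_2 power2_eq_square[symmetric])

lemma norm_dir' [simp]: "norm (dir' x) = 1"
  by (simp add: norm_eq_sqrt_inner dir_orthonormal)

lemma dir_inner_add:
  "dir x \<bullet> dir (x + t) = cos t" "dir' x \<bullet> dir (x + t) = sin t"
  "dir x \<bullet> dir' (x + t) = - sin t" "dir' x \<bullet> dir' (x + t) = cos t"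
proof -
  have e: "c * (c * C - s * S) + s * (s * C + c * S) = C" "c * (s * C + c * S) - s * (c * C - s * S) = S"
    if "s\<^sup>2 + c\<^sup>2 = 1" for s c C S :: real
  proof -
    have "c * (c * C - s * S) + s * (s * C + c * S) = (s\<^sup>2 + c\<^sup>2) * C"
      "c * (s * C + c * S) - s * (c * C - s * S) = (s\<^sup>2 + c\<^sup>2) * S"
      by (simp_all add: power2_eq_square algebra_simps)
    then show "c * (c * C - s * S) + s * (s * C + c * S) = C" "c * (s * C + c * S) - s * (c * C - s * S) = S"
      using that by simp_all
  qed
  show "dir x \<bullet> dir (x + t) = cos t" "dir' x \<bullet> dir (x + t) = sin t"
    "dir x \<bullet> dir' (x + t) = - sin t" "dir' x \<bullet> dir' (x + t) = cos t"
    using e[of "sin x" "cos x" "cos t" "sin t"]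
    by (simp_all add: inner_dir cos_add sin_add algebra_simps)
qed

lemma dir_has_vector_derivative:
  "(dir has_vector_derivative dir' x) (at x within S)"
  "(dir' has_vector_derivative - dir x) (at x within S)"
proof -
  have e: "dir = (\<lambda>x. cos x *\<^sub>R axis 1 1 + sin x *\<^sub>R axis 2 1)" "dir' = (\<lambda>x. (- sin x) *\<^sub>R axis 1 1 + cos x *\<^sub>R axis 2 1)"
    by (auto simp: fun_eq_iff vec_eq_iff forall_2 axis_def)
  have d: "((\<lambda>x. f x *\<^sub>R axis 1 1 + g x *\<^sub>R axis 2 1 :: real^2) has_vector_derivative f' *\<^sub>R axis 1 1 + g' *\<^sub>R axis 2 1) (at x within S)"
    if "(f has_real_derivative f') (at x within S)" "(g has_real_derivative g') (at x within S)" for f g f' g'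
    using has_vector_derivative_add[OF has_vector_derivative_scaleR[OF that(1) has_vector_derivative_const[of "axis 1 1"]]
        has_vector_derivative_scaleR[OF that(2) has_vector_derivative_const[of "axis 2 1"]]] by simp
  show "(dir has_vector_derivative dir' x) (at x within S)"
    unfolding e by (rule d) (auto intro!: derivative_eq_intros)
  have "- dir x = (- cos x) *\<^sub>R axis 1 1 + (- sin x) *\<^sub>R axis 2 1" by (simp add: e)
  then show "(dir' has_vector_derivative - dir x) (at x within S)"
    unfolding e(2) by (simp only:) (rule d, auto intro!: derivative_eq_intros)
qed

lemma period_representative:
  obtains k :: int where "a \<le> y + 2*pi * of_int k" "y + 2*pi * of_int k < a + 2*pi"
proof -
  define k where "k = - \<lfloor>(y - a) / (2*pi)\<rfloor>"
  have "- of_int k \<le> (y - a) / (2*pi)" "(y - a) / (2*pi) < - of_int k + 1"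
    unfolding k_def by linarith+
  then show thesis by (intro that[of k]) (auto simp: field_simps)
qed

lemma dir_exists:
  fixes a :: "real^2"
  assumes "a \<noteq> 0"
  obtains x where "a = norm a *\<^sub>R dir x"
proof -
  let ?u = "a /\<^sub>R norm a"
  have "norm ?u = 1" using assms by simp
  then have "(?u $ 1)\<^sup>2 + (?u $ 2)\<^sup>2 = 1"
    by (simp add: norm_eq_sqrt_inner inner_vec_def sum_2 power2_eq_square)
  then obtain x where "?u $ 1 = cos x" "?u $ 2 = sin x" using sincos_total_2pi by metis
  then have "?u = dir x" by (simp add: vec_eq_iff forall_2)
  then have "norm a *\<^sub>R ?u = norm a *\<^sub>R dir x" by simp
  then show thesis using that assms by simp
qed

locale C2_body =
  fixes K :: "(real^2) set"
  assumes body: "strictly_convex_C2_body K"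
begin

lemma compact: "compact K" and convex: "convex K" and nonempty: "K \<noteq> {}"
  using body by (auto simp: strictly_convex_C2_body_def)

lemma supp_upper: "v \<in> K \<Longrightarrow> v \<bullet> dir x \<le> supp K x"
  unfolding supp_def
proof (rule cSUP_upper)
  have "compact ((\<lambda>v. v \<bullet> dir x) ` K)"
    by (intro compact_continuous_image compact continuous_intros)
  then show "bdd_above ((\<lambda>v. v \<bullet> dir x) ` K)" by (intro bounded_imp_bdd_above compact_imp_bounded)
qed

lemma supp_attained: obtains v where "v \<in> K" "v \<bullet> dir x = supp K x"
proof -
  have "continuous_on K (\<lambda>v. v \<bullet> dir x)" by (intro continuous_intros)
  then obtain v where v: "v \<in> K" "\<forall>w\<in>K. w \<bullet> dir x \<le> v \<bullet> dir x"
    using continuous_attains_sup[OF compact nonempty] by metis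
  then have "supp K x \<le> v \<bullet> dir x"
    unfolding supp_def using nonempty by (intro cSUP_least) auto
  with v supp_upper that show thesis by (metis antisym)
qed

text \<open>For the converse, a hyperplane separating \<open>v\<close> from \<open>K\<close> has a
  normal of the form \<open>dir x\<close>, and in that direction \<open>v\<close> exceeds the
  support function.\<close>

lemma mem_iff: "v \<in> K \<longleftrightarrow> (\<forall>x. v \<bullet> dir x \<le> supp K x)"
proof
  assume *: "\<forall>x. v \<bullet> dir x \<le> supp K x"
  show "v \<in> K"
  proof (rule ccontr)
    assume "v \<notin> K"
    then obtain a b where ab: "a \<bullet> v < b" "\<And>w. w \<in> K \<Longrightarrow> a \<bullet> w > b"
      using separating_hyperplane_closed_point[OF convex compact_imp_closed[OF compact]] by metis
    then have "a \<noteq> 0" using nonempty by fastforce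
    then have "- a \<noteq> 0" by simp
    then obtain x where x: "- a = norm a *\<^sub>R dir x" using dir_exists[of "- a"] by auto
    obtain w where w: "w \<in> K" "w \<bullet> dir x = supp K x" using supp_attained by blast
    have "- a \<bullet> w < - a \<bullet> v" using ab w by fastforce
    then have "norm a * (w \<bullet> dir x) < norm a * (v \<bullet> dir x)"
      unfolding x by (simp add: inner_commute)
    then have "w \<bullet> dir x < v \<bullet> dir x" using \<open>a \<noteq> 0\<close> by simp
    then show False using *[rule_format, of x] w(2) by linarith
  qed
qed (auto intro: supp_upper)

sublocale convex_support "supp K" "deriv (supp K)" "deriv (deriv (supp K))"
proof
  have C2: "C2_fun (supp K)" using body by (simp add: strictly_convex_C2_body_def)
  then show "(supp K has_real_derivative deriv (supp K) x) (at x)"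
    "(deriv (supp K) has_real_derivative deriv (deriv (supp K)) x) (at x)"
    "continuous_on UNIV (deriv (deriv (supp K)))" for x
    by (auto simp: C2_fun_def DERIV_deriv_iff_real_differentiable)
  show "supp K (x + 2*pi) = supp K x" for x by (simp add: supp_def dir_periodic)
  show "0 < supp K x + deriv (deriv (supp K)) x" for x
    using body by (simp add: strictly_convex_C2_body_def)
qed

abbreviation "r x \<equiv> supp K x + deriv (deriv (supp K)) x"

text \<open>Support function of \<open>K\<close> with origin moved to \<open>P\<close>. Its zeros
  are the normal angles of support lines through \<open>P\<close>, and \<open>gap + gap''\<close> is
  the radius of curvature for every \<open>P\<close>, so \<open>sturm_comparison\<close>
  applies.\<close>

definition gap :: "real^2 \<Rightarrow> real \<Rightarrow> real" where
  "gap P x = supp K x - P \<bullet> dir x"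
definition gap' :: "real^2 \<Rightarrow> real \<Rightarrow> real" where
  "gap' P x = deriv (supp K) x - P \<bullet> dir' x"

lemma gap_deriv: "(gap P has_real_derivative gap' P x) (at x)"
  unfolding gap_def[abs_def] gap'_def inner_dir
  by (auto intro!: derivative_eq_intros p)

lemma gap'_deriv: "(gap' P has_real_derivative deriv (deriv (supp K)) x + P \<bullet> dir x) (at x)"
  unfolding gap'_def[abs_def] inner_dir
  by (auto intro!: derivative_eq_intros p')

lemma gap_periodic: "gap P (x + 2*pi * of_int k) = gap P x"
  "gap' P (x + 2*pi * of_int k) = gap' P x"
  by (rule periodic_of_int; simp add: gap_def gap'_def per per' dir_periodic)+

lemma gap_comparison:
  assumes "a \<noteq> b" "\<bar>b - a\<bar> \<le> pi"
  shows "gap P a * cos (b - a) + gap' P a * sin (b - a) < gap P b"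
  by (rule sturm_comparison[OF gap_deriv gap'_deriv _ assms]) (simp add: gap_def pos)

text \<open>Over half a turn the comparison sinusoid is a nonnegative multiple of a sine, and
  \<open>gap\<close> lies strictly above it.\<close>

lemma gap_pos_right:
  assumes "gap P a = 0" "gap' P a \<ge> 0" "a < b" "b \<le> a + pi"
  shows "gap P b > 0"
proof -
  have "sin (b - a) \<ge> 0" using assms by (intro sin_ge_zero) auto
  then have "gap' P a * sin (b - a) \<ge> 0" using assms by simp
  then show ?thesis using gap_comparison[of a b P] assms by simp
qed

lemma gap_pos_left:
  assumes "gap P a = 0" "gap' P a \<le> 0" "b < a" "a \<le> b + pi"
  shows "gap P b > 0"
proof -
  have "sin (a - b) \<ge> 0" using assms by (intro sin_ge_zero) auto
  then have "sin (b - a) \<le> 0" by (simp add: sin_diff mult.commute)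
  then have "gap' P a * sin (b - a) \<ge> 0" using assms by (simp add: mult_nonpos_nonpos)
  then show ?thesis using gap_comparison[of a b P] assms by simp
qed

lemma bdry_diff: "bdry K x - P = gap P x *\<^sub>R dir x + gap' P x *\<^sub>R dir' x"
proof -
  have "gap P x *\<^sub>R dir x + gap' P x *\<^sub>R dir' x =
      bdry K x - ((P \<bullet> dir x) *\<^sub>R dir x + (P \<bullet> dir' x) *\<^sub>R dir' x)"
    by (simp add: bdry_def gap_def gap'_def scaleR_diff_left)
  then show ?thesis by (simp only: dir_expansion[symmetric])
qed

lemma bdry_periodic: "bdry K (x + 2*pi * of_int k) = bdry K x"
  by (rule periodic_of_int) (simp add: bdry_def per per' dir_periodic)

text \<open>The intersection of the two support lines with normals at angles \<open>x\<close> and \<open>x + t\<close>.\<close>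

definition meet :: "real \<Rightarrow> real \<Rightarrow> real^2" where
  "meet x t = supp K x *\<^sub>R dir x + ((supp K (x + t) - supp K x * cos t) / sin t) *\<^sub>R dir' x"

text \<open>By \<open>bdry_diff\<close> the contact points lie at distance \<open>tangent1\<close>
  along minus \<open>dir' x\<close> and \<open>tangent2\<close> along \<open>dir' (x + t)\<close>.
  The opposite signs of \<open>gap'\<close> tell the two tangents apart.\<close>

lemma gap_meet:
  assumes t: "0 < t" "t < pi"
  shows "gap (meet x t) x = 0" "gap (meet x t) (x + t) = 0"
    "gap' (meet x t) x = - tangent1 x t" "gap' (meet x t) (x + t) = tangent2 x t"
proof -
  have s: "sin t > 0" using t by (rule sin_gt_zero)
  have c: "cos t * cos t = 1 - sin t * sin t"
    using sin_cos_squared_add[of t] by (simp add: power2_eq_square)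
  have e: "cos t * (cos t * y) + sin t * (sin t * y) = y" for y
    unfolding mult.assoc[symmetric] distrib_right[symmetric] c by simp
  show "gap (meet x t) x = 0" "gap (meet x t) (x + t) = 0" "gap' (meet x t) x = - tangent1 x t"
    using s by (simp_all add: gap_def gap'_def meet_def inner_add_left dir_orthonormal dir_inner_add tangent1_def)
  have "supp K x * sin t - (supp K (x + t) - supp K x * cos t) / sin t * cos t
      = (supp K x - supp K (x + t) * cos t) / sin t"
    using s by (simp add: field_simps e)
  then show "gap' (meet x t) (x + t) = tangent2 x t"
    by (simp add: gap'_def meet_def inner_add_left dir_inner_add tangent2_def)
qed

text \<open>No third tangent in one period: outside [x, x + t] the known zeros force positivity
  outward. A zero strictly between would, according to the sign of its slope, make
  \<open>gap\<close> positive at one of the known zeros.\<close>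

lemma gap_meet_zero:
  assumes t: "0 < t" "t < pi" and y: "x - pi \<le> y" "y < x + pi" and 0: "gap (meet x t) y = 0"
  shows "y = x \<or> y = x + t"
proof (rule ccontr)
  assume n: "\<not> (y = x \<or> y = x + t)"
  let ?P = "meet x t"
  note m = gap_meet[OF t, of x] and t1 = tangent1_pos[OF t, of x] and t2 = tangent2_pos[OF t, of x]
  consider "y < x" | "x + t < y" | "x < y" "y < x + t" using n by force
  then show False
  proof cases
    case 1 then show False using gap_pos_left[of ?P x y] m t1 y 0 by simp
  next
    case 2 then show False using gap_pos_right[of ?P "x + t" y] m t2 y t 0 by simp
  next
    case 3
    then show False
      using gap_pos_right[of ?P y "x + t"] gap_pos_left[of ?P y x] m t 0 by (cases "gap' ?P y \<ge> 0") auto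
  qed
qed

text \<open>Comparing from the middle angle to both zeros and adding cancels the slope terms, so
  \<open>gap\<close> is negative in the middle direction.\<close>

lemma meet_notin:
  assumes t: "0 < t" "t < pi"
  shows "meet x t \<notin> K"
proof
  let ?P = "meet x t" and ?y = "x + t / 2"
  assume "?P \<in> K"
  then have "gap ?P ?y \<ge> 0" using supp_upper by (simp add: gap_def)
  moreover have sc: "sin (t/2) > 0" "cos (t/2) > 0" using t by (auto intro!: sin_gt_zero cos_gt_zero_pi)
  moreover have "gap ?P ?y * cos (t/2) + gap' ?P ?y * sin (t/2) < 0"
    using gap_comparison[of ?y "x + t" ?P] gap_meet(2)[OF t, of x] t by simp
  moreover have "gap ?P ?y * cos (t/2) - gap' ?P ?y * sin (t/2) < 0"
    using gap_comparison[of ?y x ?P] gap_meet(1)[OF t, of x] t by simp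
  ultimately show False by (smt (verit) mult_nonneg_nonneg)
qed

lemma tangency_points_meet:
  assumes t: "0 < t" "t < pi"
  shows "tangency_points K (meet x t) = {bdry K x, bdry K (x + t)}"
proof
  let ?P = "meet x t"
  show "tangency_points K ?P \<subseteq> {bdry K x, bdry K (x + t)}"
  proof
    fix B assume "B \<in> tangency_points K ?P"
    then obtain y where y: "B = bdry K y" "gap ?P y = 0" by (auto simp: tangency_points_def gap_def)
    obtain k :: int where k: "x - pi \<le> y + 2*pi * of_int k" "y + 2*pi * of_int k < x - pi + 2*pi"
      using period_representative by blast
    have "y + 2*pi * of_int k = x \<or> y + 2*pi * of_int k = x + t"
      using k y by (intro gap_meet_zero[OF t]) (auto simp: gap_periodic)
    then show "B \<in> {bdry K x, bdry K (x + t)}" using bdry_periodic[of y k] y by auto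
  qed
  show "{bdry K x, bdry K (x + t)} \<subseteq> tangency_points K ?P"
    using gap_meet(1,2)[OF t, of x] by (auto simp: tangency_points_def gap_def)
qed

text \<open>The unit vectors towards the contact points have inner product -cos t = cos (pi - t).
  Distinct contact points and the symmetry of \<open>vec_angle\<close> make the described value
  unique.\<close>

lemma visual_angle_meet:
  assumes t: "0 < t" "t < pi"
  shows "visual_angle K (meet x t) = pi - t"
proof -
  let ?P = "meet x t"
  note m = gap_meet[OF t, of x] and t1 = tangent1_pos[OF t, of x] and t2 = tangent2_pos[OF t, of x]
  have A: "bdry K x - ?P = - tangent1 x t *\<^sub>R dir' x" and B: "bdry K (x + t) - ?P = tangent2 x t *\<^sub>R dir' (x + t)"
    by (simp_all add: bdry_diff m)
  have ne: "bdry K x \<noteq> bdry K (x + t)"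
  proof
    assume "bdry K x = bdry K (x + t)"
    then have "- tangent1 x t *\<^sub>R dir' x \<bullet> dir x = tangent2 x t *\<^sub>R dir' (x + t) \<bullet> dir x"
      using A B by metis
    then have "tangent2 x t * sin t = 0"
      using dir_inner_add(3)[of x t] by (simp add: dir_orthonormal inner_commute)
    then show False using t2 sin_gt_zero[OF t] by simp
  qed
  have "vec_angle (bdry K x - ?P) (bdry K (x + t) - ?P) = arccos (- cos t)"
    unfolding A B vec_angle_def using t1 t2 by (simp add: dir_inner_add)
  also have "\<dots> = arccos (cos (pi - t))" by simp
  also have "\<dots> = pi - t" using t by (intro arccos_cos) auto
  finally have v: "vec_angle (bdry K x - ?P) (bdry K (x + t) - ?P) = pi - t" .
  have sym: "vec_angle u w = vec_angle w u" for u w by (simp add: vec_angle_def inner_commute mult.commute)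
  show ?thesis
    unfolding visual_angle_def tangency_points_meet[OF t]
  proof (rule the_equality)
    show "\<exists>A B. A \<noteq> B \<and> {bdry K x, bdry K (x + t)} = {A, B} \<and> pi - t = vec_angle (A - ?P) (B - ?P)"
      using ne v by metis
  next
    fix w assume "\<exists>A B. A \<noteq> B \<and> {bdry K x, bdry K (x + t)} = {A, B} \<and> w = vec_angle (A - ?P) (B - ?P)"
    then show "w = pi - t" using v sym by (metis doubleton_eq_iff)
  qed
qed

text \<open>Half-open in x so that each direction occurs once. The condition t < pi fixes the order
  of the two tangents, so each exterior point occurs once as well.\<close>

definition param :: "(real^2) set" where
  "param = {v. v $ 1 \<in> {0..<2*pi} \<and> v $ 2 \<in> {0<..<pi}}"

text \<open>The first tangent is recognised by its negative slope \<open>gap'\<close>, so the first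
  angles agree modulo the period; then the second ones agree by
  \<open>gap_meet_zero\<close>.\<close>

lemma inj_on_meet: "inj_on (\<lambda>v. meet (v $ 1) (v $ 2)) param"
proof (rule inj_onI)
  fix u v assume uv: "u \<in> param" "v \<in> param" and eq: "meet (u $ 1) (u $ 2) = meet (v $ 1) (v $ 2)"
  define x t y s where xy: "x = u $ 1" "t = u $ 2" "y = v $ 1" "s = v $ 2"
  have t: "0 < t" "t < pi" and s: "0 < s" "s < pi" and x: "0 \<le> x" "x < 2*pi" and y: "0 \<le> y" "y < 2*pi"
    using uv by (auto simp: param_def xy)
  let ?P = "meet x t"
  have P: "?P = meet y s" using eq by (simp add: xy)
  have z: "gap ?P y = 0" "gap ?P (y + s) = 0" "gap' ?P y < 0"
    unfolding P using gap_meet[OF s, of y] tangent1_pos[OF s, of y] by auto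
  obtain k :: int where k: "x - pi \<le> y + 2*pi * of_int k" "y + 2*pi * of_int k < x - pi + 2*pi"
    using period_representative by blast
  have "y + 2*pi * of_int k = x \<or> y + 2*pi * of_int k = x + t"
    using k z by (intro gap_meet_zero[OF t]) (auto simp: gap_periodic)
  moreover have "y + 2*pi * of_int k \<noteq> x + t"
    using gap_periodic(2)[of ?P y k] z gap_meet(4)[OF t, of x] tangent2_pos[OF t, of x] by auto
  ultimately have yx: "y + 2*pi * of_int k = x" by simp
  then have "\<bar>2*pi * of_int k\<bar> < 2*pi" using x y by auto
  then have "\<bar>of_int k :: real\<bar> < 1" by (simp add: abs_mult)
  then have "k = 0" by linarith
  then have "y = x" using yx by simp
  moreover have "x + s = x \<or> x + s = x + t"
    using z(2) s \<open>y = x\<close> by (intro gap_meet_zero[OF t]) auto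
  ultimately show "u = v" using s by (auto simp: vec_eq_iff forall_2 xy)
qed

text \<open>For exterior \<open>P\<close> some direction z has negative \<open>gap\<close>. Half a
  turn away it is positive by comparison, and the intermediate value theorem yields a zero on each
  side of z.\<close>

lemma image_meet: "(\<lambda>v. meet (v $ 1) (v $ 2)) ` param = - K"
proof
  show "(\<lambda>v. meet (v $ 1) (v $ 2)) ` param \<subseteq> - K"
    using meet_notin by (auto simp: param_def)
  show "- K \<subseteq> (\<lambda>v. meet (v $ 1) (v $ 2)) ` param"
  proof
    fix P assume "P \<in> - K"
    then obtain z where "P \<bullet> dir z > supp K z" using mem_iff by (auto simp: not_le)
    then have z: "gap P z < 0" by (simp add: gap_def)
    have cont: "continuous_on S (gap P)" for S
      by (auto intro!: continuous_at_imp_continuous_on DERIV_isCont[OF gap_deriv])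
    have "gap P (z - pi) > 0" using gap_comparison[of z "z - pi" P] z by simp
    then obtain a where a: "z - pi \<le> a" "a \<le> z" "gap P a = 0"
      using IVT2'[of "gap P" z 0 "z - pi"] z cont by auto
    then have az: "a < z" using z by (cases "a = z") auto
    \<comment> \<open>Searching for the second zero only up to \<open>a + pi\<close>, where
      \<open>gap\<close> is already positive, ensures t < pi.\<close>
    have "gap P (a + pi) > 0" using gap_comparison[of a "a + pi" P] a by simp
    then obtain b where b: "z \<le> b" "b \<le> a + pi" "gap P b = 0"
      using IVT'[of "gap P" z 0 "a + pi"] z cont a by auto
    have b': "b \<noteq> a + pi" using b \<open>gap P (a + pi) > 0\<close> by auto
    define t where "t = b - a"
    have t: "0 < t" "t < pi" using az b b' by (auto simp: t_def)
    have s: "sin t > 0" using t by (rule sin_gt_zero)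
    obtain k :: int where k: "0 \<le> a + 2*pi * of_int k" "a + 2*pi * of_int k < 0 + 2*pi"
      using period_representative by blast
    define x where "x = a + 2*pi * of_int k"
    have xt: "x + t = b + 2*pi * of_int k" by (simp add: x_def t_def)
    have "gap P x = 0" "gap P (x + t) = 0"
      using a b gap_periodic(1)[of P a k] gap_periodic(1)[of P b k] unfolding xt by (auto simp: x_def)
    then have Px: "P \<bullet> dir x = supp K x" "P \<bullet> dir (x + t) = supp K (x + t)" by (auto simp: gap_def)
    have "P \<bullet> dir (x + t) = (P \<bullet> dir x) * cos t + (P \<bullet> dir' x) * sin t"
      by (subst (1) dir_expansion[of P x]) (simp only: inner_add_left inner_scaleR_left dir_inner_add)
    then have "P \<bullet> dir' x = (supp K (x + t) - supp K x * cos t) / sin t"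
      using s unfolding Px by (simp add: field_simps)
    then have "P = meet x t" using dir_expansion[of P x] by (simp add: meet_def Px)
    then have "P = (\<lambda>v. meet (v $ 1) (v $ 2)) (vector [x, t] :: real^2)" by simp
    moreover have "vector [x, t] \<in> param" using k t by (simp add: param_def x_def)
    ultimately show "P \<in> (\<lambda>v. meet (v $ 1) (v $ 2)) ` param" by blast
  qed
qed

text \<open>Written in the frame \<open>dir x\<close>, \<open>dir' x\<close>. Varying t keeps the
  point on the first support line, so the matrix is triangular in this frame and the determinant is
  read off the diagonal.\<close>

definition meet_deriv :: "real^2 \<Rightarrow> real^2 \<Rightarrow> real^2" where
  "meet_deriv v h =
    h $ 1 *\<^sub>R (- tangent1 (v $ 1) (v $ 2) *\<^sub>R dir (v $ 1) +
      (supp K (v $ 1) + (deriv (supp K) (v $ 1 + v $ 2) - deriv (supp K) (v $ 1) * cos (v $ 2)) / sin (v $ 2)) *\<^sub>R dir' (v $ 1)) +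
    h $ 2 *\<^sub>R ((tangent2 (v $ 1) (v $ 2) / sin (v $ 2)) *\<^sub>R dir' (v $ 1))"

lemma has_derivative_meet:
  assumes "sin (v $ 2) \<noteq> 0"
  shows "((\<lambda>v. meet (v $ 1) (v $ 2)) has_derivative meet_deriv v) (at v within S)"
proof -
  define x t where xt: "x = v $ 1" "t = v $ 2"
  have s: "sin t \<noteq> 0" using assms by (simp add: xt)
  have c: "cos t * cos t = 1 - sin t * sin t"
    using sin_cos_squared_add[of t] by (simp add: power2_eq_square)
  have e: "b * (cos t * (cos t * y)) + b * (sin t * (sin t * y)) = b * y" for b y
    unfolding mult.assoc[symmetric] distrib_right[symmetric]
    by (simp only: mult.assoc distrib_left[symmetric] c) simp
  have nth: "((\<lambda>v :: real^2. v $ i) has_derivative (\<lambda>h. h $ i)) (at v within S)" for i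
    by (intro bounded_linear_imp_has_derivative bounded_linear_vec_nth)
  have d: "((\<lambda>v :: real^2. dir (v $ 1)) has_derivative (\<lambda>h. h $ 1 *\<^sub>R dir' x)) (at v within S)"
    using has_derivative_compose[OF nth[of 1] dir_has_vector_derivative(1)[unfolded has_vector_derivative_def, of _ UNIV]]
    by (simp add: xt)
  have d': "((\<lambda>v :: real^2. dir' (v $ 1)) has_derivative (\<lambda>h. h $ 1 *\<^sub>R - dir x)) (at v within S)"
    using has_derivative_compose[OF nth[of 1] dir_has_vector_derivative(2)[unfolded has_vector_derivative_def, of _ UNIV]]
    by (simp add: xt)
  have p1: "((\<lambda>v :: real^2. supp K (v $ 1)) has_derivative (\<lambda>h. h $ 1 * deriv (supp K) x)) (at v within S)"
    unfolding xt by (rule DERIV_compose_FDERIV[OF p nth])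
  have p2: "((\<lambda>v :: real^2. supp K (v $ 1 + v $ 2)) has_derivative (\<lambda>h. (h $ 1 + h $ 2) * deriv (supp K) (x + t))) (at v within S)"
    unfolding xt by (rule DERIV_compose_FDERIV[OF p has_derivative_add[OF nth nth]])
  have cs: "((\<lambda>v :: real^2. cos (v $ 2)) has_derivative (\<lambda>h. h $ 2 * - sin t)) (at v within S)"
    unfolding xt by (rule DERIV_compose_FDERIV[OF DERIV_cos nth])
  have sn: "((\<lambda>v :: real^2. sin (v $ 2)) has_derivative (\<lambda>h. h $ 2 * cos t)) (at v within S)"
    unfolding xt by (rule DERIV_compose_FDERIV[OF DERIV_sin nth])
  let ?P = "supp K (x + t)" and ?p = "supp K x"
    and ?P' = "deriv (supp K) (x + t)" and ?p' = "deriv (supp K) x"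
  let ?q = "\<lambda>v :: real^2. (supp K (v $ 1 + v $ 2) - supp K (v $ 1) * cos (v $ 2)) / sin (v $ 2)"
  have q: "(?q has_derivative (\<lambda>h. h $ 1 * ((?P' - ?p' * cos t) / sin t) + h $ 2 * (tangent2 x t / sin t))) (at v within S)"
  proof -
    have "(?q has_derivative (\<lambda>h. (((h $ 1 + h $ 2) * ?P' - (?p * (h $ 2 * - sin t) + h $ 1 * ?p' * cos t)) * sin t
        - (?P - ?p * cos t) * (h $ 2 * cos t)) / (sin t * sin t))) (at v within S)"
      using has_derivative_divide'[OF has_derivative_diff[OF p2 has_derivative_mult[OF p1 cs]] sn] s
      by (simp add: xt)
    moreover have "(((a + b) * ?P' - (?p * (b * - sin t) + a * ?p' * cos t)) * sin t
        - (?P - ?p * cos t) * (b * cos t)) / (sin t * sin t)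
      = a * ((?P' - ?p' * cos t) / sin t) + b * (tangent2 x t / sin t)" for a b
    proof -
      have "((a + b) * ?P' - (?p * (b * - sin t) + a * ?p' * cos t)) * sin t - (?P - ?p * cos t) * (b * cos t)
        = a * (?P' - ?p' * cos t) * sin t + b * (?p * (sin t * sin t + cos t * cos t) - ?P * cos t + ?P' * sin t)"
        by (simp add: algebra_simps e)
      then show ?thesis unfolding c tangent2_def using s by (simp add: field_simps e)
    qed
    ultimately show ?thesis by simp
  qed
  have "((\<lambda>v. meet (v $ 1) (v $ 2)) has_derivative
    (\<lambda>h. ?p *\<^sub>R (h $ 1 *\<^sub>R dir' x) + (h $ 1 * ?p') *\<^sub>R dir x +
      (((?P - ?p * cos t) / sin t) *\<^sub>R (h $ 1 *\<^sub>R - dir x)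
       + (h $ 1 * ((?P' - ?p' * cos t) / sin t) + h $ 2 * (tangent2 x t / sin t)) *\<^sub>R dir' x))) (at v within S)"
    unfolding meet_def
    using has_derivative_add[OF has_derivative_scaleR[OF p1 d] has_derivative_scaleR[OF q d']]
    by (simp add: xt)
  then show ?thesis
    by (rule has_derivative_eq_rhs)
      (simp add: fun_eq_iff meet_deriv_def xt[symmetric] tangent1_def vec_eq_iff forall_2 algebra_simps)
qed

lemma det_meet_deriv:
  "det (matrix (meet_deriv v)) = - (tangent1 (v $ 1) (v $ 2) * tangent2 (v $ 1) (v $ 2) / sin (v $ 2))"
proof -
  have "(a * c - b * s) * (w * c) - (- w * s) * (a * s + b * c) = a * w * (s\<^sup>2 + c\<^sup>2)" for a b c s w :: real
    by (simp add: power2_eq_square algebra_simps)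
  note det = this
  define b where "b = supp K (v $ 1) + (deriv (supp K) (v $ 1 + v $ 2) - deriv (supp K) (v $ 1) * cos (v $ 2)) / sin (v $ 2)"
  define w where "w = tangent2 (v $ 1) (v $ 2) / sin (v $ 2)"
  have m: "meet_deriv v (axis 1 1) $ 1 = - tangent1 (v $ 1) (v $ 2) * cos (v $ 1) - b * sin (v $ 1)"
    "meet_deriv v (axis 1 1) $ 2 = - tangent1 (v $ 1) (v $ 2) * sin (v $ 1) + b * cos (v $ 1)"
    "meet_deriv v (axis 2 1) $ 1 = - w * sin (v $ 1)" "meet_deriv v (axis 2 1) $ 2 = w * cos (v $ 1)"
    by (simp_all add: meet_deriv_def axis_def b_def w_def)
  show ?thesis
    unfolding det_2 matrix_def vec_lambda_beta m det by (simp add: w_def)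
qed

end

section \<open>Crofton formula, length and area\<close>

lemma integral_half_open:
  fixes f :: "real \<Rightarrow> real"
  shows "integral {a..<b} f = integral {a..b} f" "integral {a<..b} f = integral {a..b} f"
    "integral {a<..<b} f = integral {a..b} f"
  by (intro integral_spike_set; rule negligible_subset[of "{a, b}"]; force)+

lemma sets_rectangle_real_2:
  assumes "X \<in> sets borel" "Y \<in> sets borel"
  shows "{v :: real^2. v $ 1 \<in> X \<and> v $ 2 \<in> Y} \<in> sets lebesgue"
proof -
  have m: "(\<lambda>v :: real^2. v $ i) \<in> borel_measurable borel" for i
    by (intro borel_measurable_continuous_onI continuous_intros)
  have "(\<lambda>v :: real^2. v $ 1) -` X \<inter> (\<lambda>v. v $ 2) -` Y \<in> sets borel"
    using measurable_sets_borel[OF m assms(1)] measurable_sets_borel[OF m assms(2)] by (intro sets.Int)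
  also have "(\<lambda>v :: real^2. v $ 1) -` X \<inter> (\<lambda>v. v $ 2) -` Y = {v. v $ 1 \<in> X \<and> v $ 2 \<in> Y}" by auto
  finally show ?thesis by (simp add: sets_completionI_sets)
qed

text \<open>Transfers the vector-valued change of variables by viewing real functions as
  \<open>real^1\<close>-valued.\<close>

lemma has_absolute_integral_change_of_variables_to_real:
  fixes f :: "real^'m::{finite,wellorder} \<Rightarrow> real" and g :: "real^'m::_ \<Rightarrow> real^'m::_"
  assumes "S \<in> sets lebesgue" "\<And>x. x \<in> S \<Longrightarrow> (g has_derivative g' x) (at x within S)" "inj_on g S"
  shows "(\<lambda>x. \<bar>det (matrix (g' x))\<bar> * f (g x)) absolutely_integrable_on S \<and>
      integral S (\<lambda>x. \<bar>det (matrix (g' x))\<bar> * f (g x)) = b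
    \<longleftrightarrow> f absolutely_integrable_on (g ` S) \<and> integral (g ` S) f = b"
proof -
  have "vec x = (vec y :: real^1) \<longleftrightarrow> x = y" for x y :: real by (simp add: vec_eq_iff)
  then show ?thesis
    using has_absolute_integral_change_of_variables[OF assms, of "\<lambda>x. vec (f x) :: real^1" "vec b"]
    by (simp add: absolutely_integrable_on_1_iff integral_on_1_eq)
qed

context C2_body begin

text \<open>Integrability on the unbounded exterior is obtained from the rectangle
  \<open>param\<close>, where kernel times Jacobian is bounded, through the equivalence in the
  change of variables.\<close>

theorem crofton_formula:
  "(\<lambda>P. crofton_kernel (visual_angle K P)) absolutely_integrable_on - K"
  "integral (- K) (\<lambda>P. crofton_kernel (visual_angle K P)) =
    - pi / 2 * (integral {0..2*pi} (\<lambda>x. (supp K x)\<^sup>2) - integral {0..2*pi} (\<lambda>x. (deriv (supp K) x)\<^sup>2))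
     - 3/2 * ((integral {0..2*pi} (\<lambda>x. supp K x * cos (2 * x)))\<^sup>2 + (integral {0..2*pi} (\<lambda>x. supp K x * sin (2 * x)))\<^sup>2)"
proof -
  let ?G = "\<lambda>x t. crofton_kernel (pi - t) * (tangent1 x t * tangent2 x t / sin t)"
  let ?X = "{0..<2*pi}" and ?Y = "{0<..<pi}"
  let ?g = "\<lambda>P. crofton_kernel (visual_angle K P)"
  have S: "param \<in> sets lebesgue" unfolding param_def by (intro sets_rectangle_real_2) auto
  have s: "sin t \<noteq> 0" if "t \<in> ?Y" for t using that sin_gt_zero[of t] by auto
  obtain B where B: "\<And>x t. 0 < t \<Longrightarrow> t < pi \<Longrightarrow> \<bar>?G x t\<bar> \<le> B"
    using crofton_tangents_bounded by blast
  have cont: "continuous_on (?X \<times> ?Y) (\<lambda>(x, t). ?G x t)"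
    unfolding case_prod_beta crofton_kernel_def tangent1_def tangent2_def
    by (intro continuous_intros) (use s in auto)
  have bd: "bounded ?X" "bounded ?Y"
    by (rule bounded_subset[OF bounded_closed_interval[of 0 "2*pi"]], force)
       (rule bounded_subset[OF bounded_closed_interval[of 0 pi]], force)
  have X: "?X \<in> sets borel" and Y: "?Y \<in> sets borel" by auto
  have B': "\<bar>?G x t\<bar> \<le> B" if "x \<in> ?X" "t \<in> ?Y" for x t using B that by auto
  note rect = integral_rectangle_real_2[OF X bd(1) Y bd(2) cont B', folded param_def]
  have eq: "\<bar>det (matrix (meet_deriv v))\<bar> * ?g (meet (v $ 1) (v $ 2)) = ?G (v $ 1) (v $ 2)"
    if "v \<in> param" for v
  proof -
    have t: "0 < v $ 2" "v $ 2 < pi" using that by (auto simp: param_def)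
    have "tangent1 (v $ 1) (v $ 2) * tangent2 (v $ 1) (v $ 2) / sin (v $ 2) \<ge> 0"
      using tangent1_pos[OF t, of "v $ 1"] tangent2_pos[OF t, of "v $ 1"] sin_gt_zero[OF t] by simp
    then show ?thesis
      unfolding det_meet_deriv abs_minus_cancel visual_angle_meet[OF t] by (simp only: abs_of_nonneg mult.commute)
  qed
  have abs: "(\<lambda>v. \<bar>det (matrix (meet_deriv v))\<bar> * ?g (meet (v $ 1) (v $ 2))) absolutely_integrable_on param"
    using rect(1) by (rule absolutely_integrable_spike[of _ _ "{}", simplified]) (use eq in auto)
  have int: "integral param (\<lambda>v. \<bar>det (matrix (meet_deriv v))\<bar> * ?g (meet (v $ 1) (v $ 2)))
      = integral param (\<lambda>v. ?G (v $ 1) (v $ 2))"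
    by (rule integral_cong) (use eq in auto)
  have "((\<lambda>v. meet (v $ 1) (v $ 2)) has_derivative meet_deriv v) (at v within param)" if "v \<in> param" for v
    by (rule has_derivative_meet) (use that s in \<open>auto simp: param_def\<close>)
  from has_absolute_integral_change_of_variables_to_real[OF S this inj_on_meet, of ?g "integral param (\<lambda>v. ?G (v $ 1) (v $ 2))"]
  have 1: "?g absolutely_integrable_on - K" "integral (- K) ?g = integral param (\<lambda>v. ?G (v $ 1) (v $ 2))"
    using abs int unfolding image_meet by auto
  show "?g absolutely_integrable_on - K" by fact
  show "integral (- K) ?g =
    - pi / 2 * (integral {0..2*pi} (\<lambda>x. (supp K x)\<^sup>2) - integral {0..2*pi} (\<lambda>x. (deriv (supp K) x)\<^sup>2))
     - 3/2 * ((integral {0..2*pi} (\<lambda>x. supp K x * cos (2 * x)))\<^sup>2 + (integral {0..2*pi} (\<lambda>x. supp K x * sin (2 * x)))\<^sup>2)"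
  proof -
    have "integral param (\<lambda>v. ?G (v $ 1) (v $ 2)) = integral ?Y (\<lambda>t. integral ?X (\<lambda>x. ?G x t))"
      by (rule rect(2))
    also have "\<dots> = integral {0..pi} (\<lambda>t. integral {0..2*pi} (\<lambda>x. ?G x t))"
      by (simp only: integral_half_open)
    finally show ?thesis
      unfolding 1(2) using integral_unique[OF integral_crofton_tangents] by (simp only:)
  qed
qed

section \<open>Length of the boundary and area enclosed by the evolute\<close>

lemma bdry_has_vector_derivative: "(bdry K has_vector_derivative r x *\<^sub>R dir' x) (at x)"
proof -
  have "((\<lambda>x. supp K x *\<^sub>R dir x + deriv (supp K) x *\<^sub>R dir' x) has_vector_derivative
     (supp K x *\<^sub>R dir' x + deriv (supp K) x *\<^sub>R dir x)
     + (deriv (supp K) x *\<^sub>R - dir x + deriv (deriv (supp K)) x *\<^sub>R dir' x)) (at x)"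
    by (intro has_vector_derivative_add has_vector_derivative_scaleR p p' dir_has_vector_derivative)
  then show ?thesis by (simp add: bdry_def[abs_def] scaleR_add_left)
qed

text \<open>Cauchy's formula: the speed is the positive radius of curvature, and its
  second-derivative part integrates to 0 by periodicity.\<close>

lemma closed_curve_length_bdry: "closed_curve_length (bdry K) = integral {0..2*pi} (supp K)"
proof -
  have n: "norm (vector_derivative (bdry K) (at x)) = r x" for x
    using pos[of x] by (simp add: vector_derivative_at[OF bdry_has_vector_derivative])
  have "((\<lambda>x. deriv (deriv (supp K)) x) has_integral (deriv (supp K) (2*pi) - deriv (supp K) 0)) {0..2*pi}"
    by (rule fundamental_theorem_of_calculus)
      (auto intro!: DERIV_subset[OF p'] simp flip: has_real_derivative_iff_has_vector_derivative)
  then have "integral {0..2*pi} (deriv (deriv (supp K))) = 0" by (simp add: per0 integral_unique)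
  moreover have "integral {0..2*pi} r = integral {0..2*pi} (supp K) + integral {0..2*pi} (deriv (deriv (supp K)))"
    by (intro integral_add integrable_continuous_real continuous_intros)
  ultimately show ?thesis by (simp add: closed_curve_length_def n)
qed

lemma evolute_area_eq:
  "evolute_area K = 1/2 * (integral {0..2*pi} (\<lambda>x. (deriv (supp K) x)\<^sup>2) -
    integral {0..2*pi} (\<lambda>x. (deriv (deriv (supp K)) x)\<^sup>2))"
proof -
  let ?f = "\<lambda>x. (deriv (supp K) x)\<^sup>2 - (deriv (deriv (supp K)) x)\<^sup>2"
  have d: "deriv (evolute_supp K) t = deriv (deriv (supp K)) (t - pi/2)" for t
    unfolding evolute_supp_def[abs_def] using p'_shift[of "- pi/2" t] by (intro DERIV_imp_deriv) simp
  \<comment> \<open>A full period turns the shift by -pi/2 into one by 3 pi/2, within the range of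
    \<open>integral_periodic_shift\<close>.\<close>
  have shift: "deriv (supp K) (t - pi/2) = deriv (supp K) (t + 3*pi/2)"
    "deriv (deriv (supp K)) (t - pi/2) = deriv (deriv (supp K)) (t + 3*pi/2)" for t
    using per'[of "t - pi/2"] per''[of "t - pi/2"] by (simp_all add: algebra_simps)
  have "integral {0..2*pi} (\<lambda>t. ?f (t + 3*pi/2)) = integral {0..2*pi} ?f"
    by (rule integral_periodic_shift) (auto intro!: continuous_intros simp: per' per'')
  also have "\<dots> = integral {0..2*pi} (\<lambda>x. (deriv (supp K) x)\<^sup>2) -
    integral {0..2*pi} (\<lambda>x. (deriv (deriv (supp K)) x)\<^sup>2)"
    by (intro integral_diff integrable_continuous_real continuous_intros)
  finally show ?thesis
    by (simp add: evolute_area_def envelope_area_def d evolute_supp_def shift)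
qed

section \<open>Boundary points, an interior point, and the area\<close>

lemma gap'_zero:
  assumes "\<And>y. gap P y \<ge> 0" "gap P x = 0"
  shows "gap' P x = 0"
  by (rule DERIV_local_min[OF gap_deriv, of 1]) (use assms in auto)

text \<open>At a zero of a nonnegative \<open>gap P\<close> the slope vanishes too, and both
  coordinates of \<open>bdry K x - P\<close> are 0. This identifies contact points without solving
  for them.\<close>

lemma bdry_eqI:
  assumes "\<And>y. gap P y \<ge> 0" "gap P x = 0"
  shows "bdry K x = P"
  using bdry_diff[of x P] gap'_zero[OF assms] assms by simp

lemma bdry_in: "bdry K x \<in> K"
proof -
  obtain v where v: "v \<in> K" "v \<bullet> dir x = supp K x" using supp_attained by blast
  then have "bdry K x = v" using supp_upper by (intro bdry_eqI) (auto simp: gap_def)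
  then show ?thesis using v by simp
qed

lemma gap_bdry: "gap (bdry K x) x = 0" "gap' (bdry K x) x = 0"
  by (simp_all add: gap_def gap'_def bdry_def inner_add_left dir_orthonormal)

lemma gap_bdry_pos:
  assumes "x - pi \<le> y" "y < x + pi" "y \<noteq> x"
  shows "gap (bdry K x) y > 0"
  using gap_pos_left[of "bdry K x" x y] gap_pos_right[of "bdry K x" x y] assms
  by (cases "y < x") (auto simp: gap_bdry)

lemma bdry_inj:
  assumes "bdry K x = bdry K y" "x \<in> {0..<2*pi}" "y \<in> {0..<2*pi}"
  shows "x = y"
proof -
  obtain k :: int where k: "x - pi \<le> y + 2*pi * of_int k" "y + 2*pi * of_int k < x - pi + 2*pi"
    using period_representative by blast
  have "gap (bdry K x) (y + 2*pi * of_int k) = 0"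
    using gap_periodic(1) gap_bdry(1)[of y] assms(1) by simp
  then have xy: "y + 2*pi * of_int k = x" using gap_bdry_pos[of x "y + 2*pi * of_int k"] k by force
  then have "\<bar>2*pi * of_int k\<bar> < 2*pi" using assms by auto
  then have "\<bar>of_int k :: real\<bar> < 1" by (simp add: abs_mult)
  then have "k = 0" by linarith
  then show ?thesis using xy by simp
qed

text \<open>The midpoint of the contact points with opposite normals works: each has a nonnegative
  gap vanishing only in its own direction, and the two directions differ.\<close>

lemma inner_point: obtains c where "c \<in> K" "\<And>x. gap c x > 0"
proof -
  define c where "c = (1/2) *\<^sub>R bdry K 0 + (1/2) *\<^sub>R bdry K pi"
  have "c \<in> K" unfolding c_def by (rule convexD[OF convex]) (auto intro: bdry_in)
  moreover have "gap c x > 0" for x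
  proof -
    obtain k :: int where k: "0 - pi \<le> x + 2*pi * of_int k" "x + 2*pi * of_int k < 0 - pi + 2*pi"
      using period_representative by blast
    define y where "y = x + 2*pi * of_int k"
    have nn: "gap (bdry K z) y \<ge> 0" for z using supp_upper[OF bdry_in] by (simp add: gap_def)
    have "gap (bdry K 0) y > 0 \<or> gap (bdry K pi) y > 0"
      using gap_bdry_pos[of 0 y] gap_bdry_pos[of pi y] k by (cases "y = 0") (auto simp: y_def[symmetric])
    then have "gap (bdry K 0) y + gap (bdry K pi) y > 0" using nn[of 0] nn[of pi] by linarith
    also have "gap (bdry K 0) y + gap (bdry K pi) y = 2 * gap c y"
      by (simp add: gap_def c_def inner_add_left)
    finally show ?thesis using gap_periodic(1)[of c x k] by (simp add: y_def)
  qed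
  ultimately show thesis using that by blast
qed

lemma continuous_gap: "continuous_on S (gap P)"
  by (auto intro!: continuous_at_imp_continuous_on DERIV_isCont[OF gap_deriv])

text \<open>Polar coordinates with centre \<open>c\<close>: the support function with respect to \<open>c\<close> is \<open>gap c\<close>.\<close>

lemma area_eq:
  "measure lebesgue K = 1/2 * (integral {0..2*pi} (\<lambda>x. (supp K x)\<^sup>2) - integral {0..2*pi} (\<lambda>x. (deriv (supp K) x)\<^sup>2))"
proof -
  obtain c where c: "c \<in> K" "\<And>x. gap c x > 0" using inner_point by blast
  let ?X = "{0..<2*pi}" and ?Y = "{0<..1 :: real}"
  define S where "S = {v :: real^2. v $ 1 \<in> ?X \<and> v $ 2 \<in> ?Y}"
  define T where "T x s = c + s *\<^sub>R (bdry K x - c)" for x s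
  define T' where "T' v h = h $ 1 *\<^sub>R ((v $ 2 * r (v $ 1)) *\<^sub>R dir' (v $ 1)) + h $ 2 *\<^sub>R (bdry K (v $ 1) - c)" for v h :: "real^2"
  have radial: "(T x s - c) \<bullet> dir x = s * gap c x" for x s
    by (simp add: T_def inner_diff_left gap_def bdry_def inner_add_left dir_orthonormal)
  have radial_le: "(T x s - c) \<bullet> dir y \<le> s * gap c y" if "s \<ge> 0" for x y s
    using that supp_upper[OF bdry_in, of x y] by (simp add: T_def inner_diff_left gap_def mult_left_mono)
  have inj: "inj_on (\<lambda>v. T (v $ 1) (v $ 2)) S"
  proof (rule inj_onI)
    fix u v assume uv: "u \<in> S" "v \<in> S" and eq: "T (u $ 1) (u $ 2) = T (v $ 1) (v $ 2)"
    have s: "u $ 2 > 0" "v $ 2 > 0" using uv by (auto simp: S_def)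
    \<comment> \<open>The radial parameter is the maximum over all directions of
      \<open>(P - c) \<bullet> dir y / gap c y\<close>, attained at the normal direction, so equal
      points have equal parameters.\<close>
    have "u $ 2 * gap c (u $ 1) \<le> v $ 2 * gap c (u $ 1)"
      using radial[of "u $ 1" "u $ 2"] radial_le[of "v $ 2" "v $ 1" "u $ 1"] s eq by simp
    moreover have "v $ 2 * gap c (v $ 1) \<le> u $ 2 * gap c (v $ 1)"
      using radial[of "v $ 1" "v $ 2"] radial_le[of "u $ 2" "u $ 1" "v $ 1"] s eq by simp
    ultimately have s_eq: "u $ 2 = v $ 2" using c(2) by (simp add: antisym)
    then have "bdry K (u $ 1) = bdry K (v $ 1)" using eq s by (simp add: T_def)
    then have "u $ 1 = v $ 1" using uv by (intro bdry_inj) (auto simp: S_def)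
    then show "u = v" using s_eq by (simp add: vec_eq_iff forall_2)
  qed
  have image: "(\<lambda>v. T (v $ 1) (v $ 2)) ` S = K - {c}"
  proof
    show "(\<lambda>v. T (v $ 1) (v $ 2)) ` S \<subseteq> K - {c}"
    proof
      fix P assume "P \<in> (\<lambda>v. T (v $ 1) (v $ 2)) ` S"
      then obtain x s where P: "P = T x s" "0 < s" "s \<le> 1" by (auto simp: S_def)
      have "T x s = (1 - s) *\<^sub>R c + s *\<^sub>R bdry K x" by (simp add: T_def algebra_simps)
      then have "P \<in> K" unfolding P(1) using P convexD[OF convex c(1) bdry_in[of x], of "1 - s" s] by simp
      moreover have "P \<noteq> c"
      proof
        assume "P = c"
        then have "s * gap c x = 0" using radial[of x s] P(1) by simp
        then show False using P c(2)[of x] by simp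
      qed
      ultimately show "P \<in> K - {c}" by simp
    qed
    show "K - {c} \<subseteq> (\<lambda>v. T (v $ 1) (v $ 2)) ` S"
    proof
      fix P assume P: "P \<in> K - {c}"
      \<comment> \<open>The maximum of this ratio is the Minkowski functional of \<open>K\<close>
        about \<open>c\<close>; a maximising direction is a normal where the ray from
        \<open>c\<close> through \<open>P\<close> leaves \<open>K\<close>.\<close>
      let ?u = "\<lambda>x. (P - c) \<bullet> dir x / gap c x"
      have u_per: "?u (x + 2*pi * of_int k) = ?u x" for x k
        by (rule periodic_of_int) (simp add: dir_periodic gap_def per)
      have "continuous_on {0..2*pi} ?u"
        unfolding inner_dir
        by (intro continuous_intros continuous_gap) (use c(2) in \<open>auto simp: less_imp_neq[symmetric]\<close>)
      then obtain z where z: "z \<in> {0..2*pi}" "\<And>x. x \<in> {0..2*pi} \<Longrightarrow> ?u x \<le> ?u z"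
        using continuous_attains_sup[of "{0..2*pi}" ?u] by auto
      have z_max: "?u x \<le> ?u z" for x
      proof -
        obtain k :: int where "0 \<le> x + 2*pi * of_int k" "x + 2*pi * of_int k < 0 + 2*pi"
          using period_representative by blast
        then show ?thesis using z(2)[of "x + 2*pi * of_int k"] u_per[of x k] by simp
      qed
      obtain k :: int where k: "0 \<le> z + 2*pi * of_int k" "z + 2*pi * of_int k < 0 + 2*pi"
        using period_representative by blast
      define x where "x = z + 2*pi * of_int k"
      define s where "s = ?u x"
      have max: "(P - c) \<bullet> dir y \<le> s * gap c y" for y
        using z_max[of y] u_per[of z k] c(2)[of y] by (simp add: s_def x_def field_simps)
      have "P - c \<noteq> 0" using P by simp
      then obtain w where w: "P - c = norm (P - c) *\<^sub>R dir w" using dir_exists by blast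
      then have "(P - c) \<bullet> dir w = norm (P - c)" by (metis dir_orthonormal(1) inner_scaleR_left mult.right_neutral)
      \<comment> \<open>Testing the bound in the direction of \<open>P - c\<close> itself shows that
        the maximal ratio is positive.\<close>
      then have "0 < s * gap c w" using max[of w] \<open>P - c \<noteq> 0\<close> by (metis zero_less_norm_iff order_less_le_trans)
      then have s: "s > 0" using c(2)[of w] by (simp add: zero_less_mult_iff)
      have "(P - c) \<bullet> dir x \<le> gap c x" using P supp_upper[of P x] by (simp add: gap_def inner_diff_left)
      then have s1: "s \<le> 1" using c(2)[of x] by (simp add: s_def)
      have "bdry K x = c + (1/s) *\<^sub>R (P - c)"
      proof (rule bdry_eqI)
        have g: "gap (c + (1/s) *\<^sub>R (P - c)) y = gap c y - (P - c) \<bullet> dir y / s" for y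
          by (simp add: gap_def inner_add_left)
        show "gap (c + (1/s) *\<^sub>R (P - c)) y \<ge> 0" for y
          using max[of y] s unfolding g by (simp add: field_simps)
        show "gap (c + (1/s) *\<^sub>R (P - c)) x = 0"
          using s c(2)[of x] unfolding g by (auto simp: s_def)
      qed
      then have "P = T x s" using s by (simp add: T_def)
      then have "P = (\<lambda>v. T (v $ 1) (v $ 2)) (vector [x, s] :: real^2)" by simp
      moreover have "(vector [x, s] :: real^2) \<in> S" using k s s1 by (simp add: S_def x_def)
      ultimately show "P \<in> (\<lambda>v. T (v $ 1) (v $ 2)) ` S" by blast
    qed
  qed
  have der: "((\<lambda>v. T (v $ 1) (v $ 2)) has_derivative T' v) (at v within S)" for v
  proof -
    have nth: "((\<lambda>v :: real^2. v $ i) has_derivative (\<lambda>h. h $ i)) (at v within S)" for i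
      by (intro bounded_linear_imp_has_derivative bounded_linear_vec_nth)
    have b: "((\<lambda>v :: real^2. bdry K (v $ 1)) has_derivative (\<lambda>h. h $ 1 *\<^sub>R (r (v $ 1) *\<^sub>R dir' (v $ 1)))) (at v within S)"
      by (rule has_derivative_compose[OF nth[of 1] bdry_has_vector_derivative[unfolded has_vector_derivative_def]])
    show ?thesis
      unfolding T_def
      by (rule has_derivative_eq_rhs,
          rule has_derivative_add[OF has_derivative_const has_derivative_scaleR[OF nth has_derivative_diff[OF b has_derivative_const]]])
        (simp add: fun_eq_iff T'_def mult_ac)
  qed
  have det: "det (matrix (T' v)) = - (v $ 2 * (r (v $ 1) * gap c (v $ 1)))" for v
  proof -
    have g: "gap c (v $ 1) = (bdry K (v $ 1) - c) $ 1 * cos (v $ 1) + (bdry K (v $ 1) - c) $ 2 * sin (v $ 1)"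
      using radial[of "v $ 1" 1] by (simp add: T_def inner_dir)
    have m: "T' v (axis 1 1) $ 1 = - (v $ 2 * r (v $ 1)) * sin (v $ 1)"
      "T' v (axis 1 1) $ 2 = v $ 2 * r (v $ 1) * cos (v $ 1)"
      "T' v (axis 2 1) $ i = (bdry K (v $ 1) - c) $ i" for i
      by (simp_all add: T'_def axis_def)
    show ?thesis
      unfolding det_2 matrix_def vec_lambda_beta m g by (simp add: algebra_simps)
  qed
  let ?G = "\<lambda>x s. s * (r x * gap c x)"
  have cr: "continuous_on A (\<lambda>x. r x * gap c x)" for A by (intro continuous_intros continuous_gap)
  have "compact ((\<lambda>x. r x * gap c x) ` {0..2*pi})" by (intro compact_continuous_image cr) auto
  then obtain B where B: "\<And>x. x \<in> {0..2*pi} \<Longrightarrow> \<bar>r x * gap c x\<bar> \<le> B"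
    by (force dest!: compact_imp_bounded simp: bounded_iff)
  have GB: "\<bar>?G x s\<bar> \<le> B" if "x \<in> ?X" "s \<in> ?Y" for x s
  proof -
    have "\<bar>?G x s\<bar> = s * \<bar>r x * gap c x\<bar>" using that by (simp add: abs_mult)
    also have "\<dots> \<le> 1 * B" using that B[of x] by (intro mult_mono) auto
    finally show ?thesis by simp
  qed
  have cG: "continuous_on (?X \<times> ?Y) (\<lambda>(x, s). ?G x s)"
    unfolding case_prod_beta
    by (intro continuous_intros continuous_on_compose2[OF continuous_gap[of UNIV c]]) auto
  have bd: "bounded ?X" "bounded ?Y"
    by (rule bounded_subset[OF bounded_closed_interval[of 0 "2*pi"]], force)
       (rule bounded_subset[OF bounded_closed_interval[of 0 1]], force)
  have X: "?X \<in> sets borel" and Y: "?Y \<in> sets borel" by auto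
  note rect = integral_rectangle_real_2[OF X bd(1) Y bd(2) cG GB, folded S_def]
  have eq: "\<bar>det (matrix (T' v))\<bar> * 1 = ?G (v $ 1) (v $ 2)" if "v \<in> S" for v
    using that c(2)[of "v $ 1"] pos[of "v $ 1"] by (simp add: det S_def abs_mult)
  have abs: "(\<lambda>v. \<bar>det (matrix (T' v))\<bar> * (1::real)) absolutely_integrable_on S"
    using rect(1) by (rule absolutely_integrable_spike[of _ _ "{}", simplified]) (use eq in auto)
  have int: "integral S (\<lambda>v. \<bar>det (matrix (T' v))\<bar> * 1) = integral S (\<lambda>v. ?G (v $ 1) (v $ 2))"
    by (rule integral_cong) (use eq in auto)
  have "S \<in> sets lebesgue" unfolding S_def by (intro sets_rectangle_real_2) auto
  from has_absolute_integral_change_of_variables_to_real[OF this der inj, of "\<lambda>_. 1" "integral S (\<lambda>v. ?G (v $ 1) (v $ 2))"]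
  have "integral (K - {c}) (\<lambda>_. 1) = integral S (\<lambda>v. ?G (v $ 1) (v $ 2))"
    using abs int unfolding image by auto
  moreover have "integral (K - {c}) (\<lambda>_. 1 :: real) = integral K (\<lambda>_. 1)"
    by (intro integral_spike_set; rule negligible_subset[of "{c}"]; force)
  moreover have "integral K (\<lambda>_. 1) = measure lebesgue K"
    using lmeasure_integral[OF lmeasurable_compact[OF compact]] by simp
  moreover have "integral S (\<lambda>v. ?G (v $ 1) (v $ 2)) = 1/2 * integral {0..2*pi} (\<lambda>x. r x * gap c x)"
  proof -
    have "integral {0..1} (\<lambda>s. s * I) = 1/2 * I" for I :: real
      using integral_mult_left[of "{0..1}" "\<lambda>s. s" I] ident_has_integral[of 0 "1::real"]
      by (simp add: integral_unique)
    moreover have "integral S (\<lambda>v. ?G (v $ 1) (v $ 2)) = integral ?Y (\<lambda>s. integral ?X (\<lambda>x. ?G x s))"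
      by (rule rect(2))
    ultimately show ?thesis by (simp add: integral_half_open)
  qed
  moreover have "integral {0..2*pi} (\<lambda>x. r x * gap c x) =
      integral {0..2*pi} (\<lambda>x. (supp K x)\<^sup>2) - integral {0..2*pi} (\<lambda>x. (deriv (supp K) x)\<^sup>2)"
  proof -
    let ?p = "supp K" and ?p' = "deriv (supp K)" and ?p'' = "deriv (deriv (supp K))"
    let ?I = "\<lambda>f :: real \<Rightarrow> real. integral {0..2*pi} f"
    have hi: "(f has_integral ?I f) {0..2*pi}" if "continuous_on {0..2*pi} f" for f
      using that by (intro integrable_integral integrable_continuous_real)
    have "r x * gap c x = (?p x)\<^sup>2 + ?p x * ?p'' x
        - c $ 1 * (?p x * cos x) - c $ 2 * (?p x * sin x) - c $ 1 * (?p'' x * cos x) - c $ 2 * (?p'' x * sin x)" for x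
      by (simp add: gap_def inner_dir power2_eq_square algebra_simps)
    then have "((\<lambda>x. r x * gap c x) has_integral ?I (\<lambda>x. (?p x)\<^sup>2) + ?I (\<lambda>x. ?p x * ?p'' x)
        - c $ 1 * ?I (\<lambda>x. ?p x * cos x) - c $ 2 * ?I (\<lambda>x. ?p x * sin x)
        - c $ 1 * ?I (\<lambda>x. ?p'' x * cos x) - c $ 2 * ?I (\<lambda>x. ?p'' x * sin x)) {0..2*pi}"
      by (simp only:) (intro has_integral_add has_integral_diff has_integral_mult_right hi continuous_intros)
    moreover have "?I (\<lambda>x. ?p x * ?p'' x) = - ?I (\<lambda>x. (?p' x)\<^sup>2)"
      using autocorr''_0 by (simp add: autocorr''_def)
    \<comment> \<open>Translation invariance: p + p'' has no first harmonic, so the centre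
      \<open>c\<close> drops out of the area.\<close>
    moreover have "?I (\<lambda>x. ?p'' x * trig (1, b) x) = - ?I (\<lambda>x. ?p x * trig (1, b) x)" for b
    proof -
      have c': "continuous_on UNIV ?p'" by (intro continuous_intros)
      show ?thesis
        using trig_coefficient_deriv[OF p' cont(1), of 1 b] trig_coefficient_deriv[OF p c', of 1 "\<not> b"]
        by (cases b) (simp_all add: per0)
    qed
    from this[of True] this[of False] have "?I (\<lambda>x. ?p'' x * cos x) = - ?I (\<lambda>x. ?p x * cos x)"
      "?I (\<lambda>x. ?p'' x * sin x) = - ?I (\<lambda>x. ?p x * sin x)"
      by (simp_all add: trig_def)
    ultimately show ?thesis by (simp add: integral_unique)
  qed
  ultimately show ?thesis by simp
qed

end

section \<open>Removing the low harmonics\<close>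

definition trig_coeff :: "(real \<Rightarrow> real) \<Rightarrow> nat \<times> bool \<Rightarrow> real" where
  "trig_coeff f j = integral {0..2*pi} (\<lambda>x. f x * trig j x)"

text \<open>At \<open>(0, False)\<close> the quotient is a division by 0 with value 0, matching the
  zero basis function.\<close>

definition trig_proj :: "nat \<Rightarrow> (real \<Rightarrow> real) \<Rightarrow> real \<Rightarrow> real" where
  "trig_proj N f x = (\<Sum>j\<in>{..N} \<times> UNIV. trig_coeff f j / trig_norm2 j * trig j x)"

lemma trig_coeff_0_False: "trig_coeff f (0, False) = 0"
  by (simp add: trig_coeff_def trig_def)

lemma trig_coeff_eq_0: "trig_norm2 j = 0 \<Longrightarrow> trig_coeff f j = 0"
  using trig_coeff_0_False by (cases j) (auto simp: trig_norm2_def split: if_splits)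

lemma integral_sq_trig_proj:
  assumes "continuous_on {0..2*pi} f"
  shows "integral {0..2*pi} (\<lambda>x. (f x - trig_proj N f x)\<^sup>2) =
    integral {0..2*pi} (\<lambda>x. (f x)\<^sup>2) - (\<Sum>j\<in>{..N} \<times> UNIV. (trig_coeff f j)\<^sup>2 / trig_norm2 j)"
proof -
  have "(trig_coeff f j / trig_norm2 j)\<^sup>2 * trig_norm2 j = trig_coeff f j / trig_norm2 j * trig_coeff f j" for j
    by (cases "trig_norm2 j = 0") (simp_all add: power2_eq_square)
  then show ?thesis
    unfolding trig_proj_def
    by (subst integral_sq_diff_trig[OF assms])
      (simp_all add: sum_distrib_left power2_eq_square flip: trig_coeff_def)
qed

lemma trig_coeff_diff_trig_proj:
  assumes f: "continuous_on {0..2*pi} f" and n: "n \<le> N"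
  shows "integral {0..2*pi} (\<lambda>x. (f x - trig_proj N f x) * trig (n, b) x) = 0"
proof -
  let ?J = "{..N} \<times> (UNIV :: bool set)"
  let ?a = "\<lambda>j. trig_coeff f j / trig_norm2 j"
  have hi: "(g has_integral integral {0..2*pi} g) {0..2*pi}" if "continuous_on {0..2*pi} g" for g :: "real \<Rightarrow> real"
    using that by (intro integrable_integral integrable_continuous_real)
  have eq: "(f x - trig_proj N f x) * trig (n, b) x
      = f x * trig (n, b) x - (\<Sum>j\<in>?J. ?a j * (trig j x * trig (n, b) x))" for x
    by (simp add: trig_proj_def left_diff_distrib sum_distrib_right mult.assoc)
  have "((\<lambda>x. (f x - trig_proj N f x) * trig (n, b) x) has_integral
      (trig_coeff f (n, b) - (\<Sum>j\<in>?J. ?a j * integral {0..2*pi} (\<lambda>x. trig j x * trig (n, b) x)))) {0..2*pi}"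
    unfolding eq trig_coeff_def[of f "(n, b)"]
    by (intro has_integral_diff has_integral_sum has_integral_mult_right hi continuous_intros f) auto
  moreover have "(\<Sum>j\<in>?J. ?a j * integral {0..2*pi} (\<lambda>x. trig j x * trig (n, b) x)) = trig_coeff f (n, b)"
    using n trig_coeff_eq_0[of "(n, b)" f]
    by (simp add: integral_trig_mult if_distrib[of "\<lambda>y. _ * y"] sum.delta cong: if_cong)
  ultimately show ?thesis by (simp add: integral_unique)
qed

text \<open>Projection commutes with differentiation, so the derivatives of the remainder of
  \<open>p\<close> are the remainders of \<open>p'\<close> and \<open>p''\<close>.\<close>

lemma trig_proj_deriv:
  assumes "\<And>x. (f has_real_derivative f' x) (at x)" "continuous_on UNIV f'" "f (2*pi) = f 0"
  shows "(trig_proj N f has_real_derivative trig_proj N f' x) (at x)"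
proof -
  have d: "(trig (n, b) has_real_derivative (if b then - real n else real n) * trig (n, \<not> b) x) (at x)" for n b
    by (cases b) (auto simp: trig_def[abs_def] intro!: derivative_eq_intros)
  have c: "trig_coeff f' (n, b) = (if b then real n else - real n) * trig_coeff f (n, \<not> b)" for n b
    unfolding trig_coeff_def by (rule trig_coefficient_deriv[OF assms])
  have "((\<lambda>x. \<Sum>n\<le>N. trig_coeff f (n, True) / trig_norm2 (n, True) * trig (n, True) x
      + trig_coeff f (n, False) / trig_norm2 (n, False) * trig (n, False) x) has_real_derivative
    (\<Sum>n\<le>N. trig_coeff f (n, True) / trig_norm2 (n, True) * (- real n * trig (n, False) x)
      + trig_coeff f (n, False) / trig_norm2 (n, False) * (real n * trig (n, True) x))) (at x)"
    using d[of _ True] d[of _ False] by (intro DERIV_sum DERIV_add DERIV_cmult) auto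
  also have "(\<Sum>n\<le>N. trig_coeff f (n, True) / trig_norm2 (n, True) * (- real n * trig (n, False) x)
      + trig_coeff f (n, False) / trig_norm2 (n, False) * (real n * trig (n, True) x)) = trig_proj N f' x"
    unfolding trig_proj_def sum_trig_index
    by (rule sum.cong) (auto simp: c trig_norm2_def mult_ac)
  finally show ?thesis unfolding trig_proj_def[abs_def] sum_trig_index .
qed

lemma trig_proj_periodic: "trig_proj N f (x + 2*pi) = trig_proj N f x"
proof -
  have "cis (real n * (x + 2*pi)) = cis (real n * x)" for n
    using cis_multiple_2pi[of "real n"] by (simp add: distrib_left cis_mult[symmetric] mult_ac)
  then have "trig (n, b) (x + 2*pi) = trig (n, b) x" for n b
    by (cases b) (auto simp: trig_def complex_eq_iff)
  then show ?thesis by (simp add: trig_proj_def sum_trig_index)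
qed

lemma continuous_trig_proj [continuous_intros]:
  "continuous_on S g \<Longrightarrow> continuous_on S (\<lambda>x. trig_proj N f (g x))"
  unfolding trig_proj_def by (intro continuous_intros)

context periodic_C2 begin

lemma periodic_C2_diff_trig_proj:
  "periodic_C2 (\<lambda>x. p x - trig_proj N p x) (\<lambda>x. p' x - trig_proj N p' x) (\<lambda>x. p'' x - trig_proj N p'' x)"
proof
  have c: "continuous_on UNIV p'" by (intro continuous_intros)
  show "((\<lambda>x. p x - trig_proj N p x) has_real_derivative p' x - trig_proj N p' x) (at x)" for x
    by (intro DERIV_diff p trig_proj_deriv[OF p c]) (simp add: per0)
  show "((\<lambda>x. p' x - trig_proj N p' x) has_real_derivative p'' x - trig_proj N p'' x) (at x)" for x
    by (intro DERIV_diff p' trig_proj_deriv[OF p' cont]) (simp add: per0)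
qed (auto intro!: continuous_intros simp: per trig_proj_periodic)

text \<open>For the equality case: the energy of a function does not bound that of its second
  derivative, so the function is shown to vanish identically.\<close>

lemma sq_integral_eq_0_imp:
  assumes "integral {0..2*pi} (\<lambda>x. (p x)\<^sup>2) = 0"
  shows "p'' x = 0"
proof -
  have z: "p x = 0" if "x \<in> {0..2*pi}" for x
  proof -
    have "continuous_on {0..2*pi} (\<lambda>x. (p x)\<^sup>2)" by (intro continuous_intros)
    from integral_eq_0_iff[OF this] show ?thesis using assms that by auto
  qed
  have "p x = 0" for x
  proof -
    obtain k :: int where "0 \<le> x + 2*pi * of_int k" "x + 2*pi * of_int k < 0 + 2*pi"
      using period_representative by blast
    then show ?thesis using z[of "x + 2*pi * of_int k"] periodic_of_int[of p x k, OF per] by simp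
  qed
  then have p0: "p = (\<lambda>_. 0)" by auto
  have p'0: "p' = (\<lambda>_. 0)" using p DERIV_const DERIV_unique unfolding p0 by blast
  show ?thesis using p' DERIV_const DERIV_unique unfolding p'0 by blast
qed

text \<open>The third claim is C + 9A - 10B = (C - 18B + 81A) + 8(B - 9A), where the first bracket
  is the integral of \<open>(p'' x + 9 * p x)\<^sup>2\<close> and the second is controlled by
  \<open>wirtinger\<close>.\<close>

lemma sq_integral_gap:
  assumes "\<And>n b. n < 3 \<Longrightarrow> integral {0..2*pi} (\<lambda>x. p x * trig (n, b) x) = 0"
  defines "A \<equiv> integral {0..2*pi} (\<lambda>x. (p x)\<^sup>2)" and "B \<equiv> integral {0..2*pi} (\<lambda>x. (p' x)\<^sup>2)"
    and "C \<equiv> integral {0..2*pi} (\<lambda>x. (p'' x)\<^sup>2)"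
  shows "A \<ge> 0" "9 * A \<le> B" "10 * B \<le> C + 9 * A" "A = 0 \<Longrightarrow> C = 0"
proof -
  have i: "f integrable_on {0..2*pi}" if "continuous_on {0..2*pi} f" for f :: "real \<Rightarrow> real"
    using that by (rule integrable_continuous_real)
  show "A \<ge> 0" unfolding A_def by (intro integral_nonneg i continuous_intros) auto
  have c: "continuous_on UNIV p'" by (intro continuous_intros)
  show B: "9 * A \<le> B"
    using wirtinger[OF p c per assms(1), of 3] by (simp add: A_def B_def)
  have hi: "(f has_integral integral {0..2*pi} f) {0..2*pi}" if "continuous_on {0..2*pi} f" for f :: "real \<Rightarrow> real"
    using i[OF that] by (rule integrable_integral)
  have "integral {0..2*pi} (\<lambda>x. p x * p'' x) = - B"
    using autocorr''_0 by (simp add: autocorr''_def B_def)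
  moreover have eq: "(p'' x + 9 * p x)\<^sup>2 = (p'' x)\<^sup>2 + 18 * (p x * p'' x) + 81 * (p x)\<^sup>2" for x
    by (simp add: power2_eq_square algebra_simps)
  have "((\<lambda>x. (p'' x + 9 * p x)\<^sup>2) has_integral C + 18 * integral {0..2*pi} (\<lambda>x. p x * p'' x) + 81 * A) {0..2*pi}"
    unfolding eq A_def C_def by (intro has_integral_add has_integral_mult_right hi continuous_intros)
  then have "0 \<le> C + 18 * integral {0..2*pi} (\<lambda>x. p x * p'' x) + 81 * A"
    by (rule has_integral_nonneg) simp
  ultimately show "10 * B \<le> C + 9 * A" using B by simp
  show "C = 0" if "A = 0" using sq_integral_eq_0_imp that by (simp add: A_def C_def)
qed

end

theorem theorem4p1:
  fixes K :: "(real^2) set" and F L Fe \<Delta> R :: real and g :: "real^2 \<Rightarrow> real"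
  assumes K: "strictly_convex_C2_body K"
    and F: "F = measure lebesgue K"
    and L: "L = closed_curve_length (bdry K)"
    and Fe: "Fe = evolute_area K"
    and \<Delta>: "\<Delta> = L\<^sup>2 - 4 * pi * F"
    and g: "g = (\<lambda>P. visual_angle K P - sin (visual_angle K P) - 2/3 * sin (visual_angle K P) ^ 3)"
    and R: "R = 5/4 * L\<^sup>2 + 5 * (LINT P:-K|lebesgue. g P)"
  shows "set_integrable lebesgue (-K) g \<and>
    pi * \<bar>Fe\<bar> - \<Delta> \<ge> R \<and>
    (pi * \<bar>Fe\<bar> - \<Delta> \<noteq> 0 \<longrightarrow> R > 0) \<and>
    (pi * \<bar>Fe\<bar> - \<Delta> = 0 \<longrightarrow> R = 0)"
proof -
  interpret C2_body K by unfold_locales (rule K)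
  let ?p = "supp K" and ?p' = "deriv (supp K)" and ?p'' = "deriv (deriv (supp K))"
  let ?I = "\<lambda>f :: real \<Rightarrow> real. integral {0..2*pi} f"
  let ?q = "\<lambda>x. ?p x - trig_proj 2 ?p x" and ?q' = "\<lambda>x. ?p' x - trig_proj 2 ?p' x"
    and ?q'' = "\<lambda>x. ?p'' x - trig_proj 2 ?p'' x"
  define P0 P1 P2 where "P0 = ?I (\<lambda>x. (?p x)\<^sup>2)" and "P1 = ?I (\<lambda>x. (?p' x)\<^sup>2)" and "P2 = ?I (\<lambda>x. (?p'' x)\<^sup>2)"
  define A B C where "A = ?I (\<lambda>x. (?q x)\<^sup>2)" and "B = ?I (\<lambda>x. (?q' x)\<^sup>2)" and "C = ?I (\<lambda>x. (?q'' x)\<^sup>2)"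
  define M where "M n = (trig_coeff ?p (n, True))\<^sup>2 + (trig_coeff ?p (n, False))\<^sup>2" for n
  interpret q: periodic_C2 ?q ?q' ?q'' by (rule periodic_C2_diff_trig_proj)
  have c: "continuous_on {0..2*pi} ?p" "continuous_on {0..2*pi} ?p'" "continuous_on {0..2*pi} ?p''"
    and c': "continuous_on UNIV ?p'"
    by (intro continuous_intros)+
  have "?I (\<lambda>x. ?q x * trig (n, b) x) = 0" if "n < 3" for n b
    using that by (intro trig_coeff_diff_trig_proj c) simp
  note gap = q.sq_integral_gap[OF this, folded A_def B_def C_def]
  have Lp: "L = ?I ?p" unfolding L by (rule closed_curve_length_bdry)
  have coeff0: "trig_coeff ?p (0, True) = L" by (simp add: trig_coeff_def trig_def Lp)
  have coeff': "trig_coeff ?p' (n, b) = (if b then real n else - real n) * trig_coeff ?p (n, \<not> b)" for n b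
    unfolding trig_coeff_def by (rule trig_coefficient_deriv[OF p c']) (simp add: per0)
  have coeff'': "trig_coeff ?p'' (n, b) = (if b then real n else - real n) * trig_coeff ?p' (n, \<not> b)" for n b
    unfolding trig_coeff_def by (rule trig_coefficient_deriv[OF p' cont]) (simp add: per0)
  have A: "A = P0 - L\<^sup>2 / (2*pi) - M 1 / pi - M 2 / pi"
    unfolding A_def P0_def integral_sq_trig_proj[OF c(1)] sum_trig_index
    by (simp add: numeral_2_eq_2 M_def trig_norm2_def coeff0 trig_coeff_0_False add_divide_distrib)
  have B: "B = P1 - M 1 / pi - 4 * M 2 / pi"
    unfolding B_def P1_def integral_sq_trig_proj[OF c(2)] sum_trig_index
    by (simp add: numeral_2_eq_2 M_def trig_norm2_def coeff' add_divide_distrib power_mult_distrib)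
  have C: "C = P2 - M 1 / pi - 16 * M 2 / pi"
    unfolding C_def P2_def integral_sq_trig_proj[OF c(3)] sum_trig_index
    by (simp add: numeral_2_eq_2 M_def trig_norm2_def coeff' coeff'' add_divide_distrib power_mult_distrib)
  have g': "g = (\<lambda>P. crofton_kernel (visual_angle K P))" by (simp add: g crofton_kernel_def)
  have int: "set_integrable lebesgue (-K) g" unfolding g' by (rule crofton_formula(1))
  have "(LINT P:-K|lebesgue. g P) = - pi / 2 * (P0 - P1) - 3/2 * M 2"
    unfolding set_lebesgue_integral_eq_integral(2)[OF int] unfolding g' crofton_formula(2)
    by (simp add: P0_def P1_def M_def trig_coeff_def trig_def)
  then have "R = 5/4 * L\<^sup>2 + 5 * (- pi / 2 * (P0 - P1) - 3/2 * M 2)" by (simp only: R)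
  \<comment> \<open>The weight n^2 - 1 is -1, 0 and 3 at n = 0, 1, 2; these cancel the L^2 term,
    nothing, and \<open>M 2\<close> respectively.\<close>
  also have "\<dots> = 5 * pi / 2 * (B - A)"
    unfolding A B by (simp add: algebra_simps add_divide_distrib diff_divide_distrib)
  finally have R': "R = 5 * pi / 2 * (B - A)" .
  have Fe': "Fe = 1/2 * (P1 - P2)" unfolding Fe evolute_area_eq P1_def P2_def ..
  have F': "F = 1/2 * (P0 - P1)" unfolding F area_eq P0_def P1_def ..
  have H: "- pi * Fe - \<Delta> = pi / 2 * (C - 5 * B + 4 * A)"
    unfolding \<Delta> Fe' F' A B C by (simp add: field_simps)
  \<comment> \<open>For the inequality alone the sign of \<open>Fe\<close> is immaterial; it is
    settled below only when \<open>R = 0\<close>.\<close>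
  have "pi * \<bar>Fe\<bar> \<ge> - pi * Fe" using mult_left_mono[of "- Fe" "\<bar>Fe\<bar>" pi] by simp
  moreover have "pi / 2 * (C - 5 * B + 4 * A) \<ge> pi / 2 * (5 * (B - A))"
    using gap by (intro mult_left_mono) auto
  ultimately have main: "pi * \<bar>Fe\<bar> - \<Delta> \<ge> R"
    using H R' by (simp only: mult.assoc mult.left_commute[of 5] times_divide_eq_left)
  have R_nonneg: "R \<ge> 0" unfolding R' using gap by simp
  have "pi * \<bar>Fe\<bar> - \<Delta> = 0" if "R = 0"
  proof -
    \<comment> \<open>\<open>R = 0\<close> means A = B, and 9A <= B with A >= 0 forces both to
      vanish.\<close>
    have "A = 0" "B = 0" using that gap by (auto simp: R')
    with gap(4) have "C = 0" by simp
    then have "P1 = M 1 / pi + 4 * M 2 / pi" "P2 = M 1 / pi + 16 * M 2 / pi"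
      using \<open>B = 0\<close> unfolding B C by simp_all
    \<comment> \<open>Only orders up to 2 remain, and order 2 enters with weight (4 - 16)/2 = -6, so
      \<open>Fe\<close> is nonpositive and H becomes an exact evaluation of the left side.\<close>
    then have "Fe = - (6 * M 2 / pi)" unfolding Fe' by simp
    moreover have "M 2 \<ge> 0" by (simp add: M_def)
    ultimately have "\<bar>Fe\<bar> = - Fe" by simp
    then show ?thesis using H \<open>A = 0\<close> \<open>B = 0\<close> \<open>C = 0\<close> by simp
  qed
  \<comment> \<open>If the left side is 0, \<open>main\<close> and \<open>R_nonneg\<close> squeeze
    \<open>R\<close> to 0; if not, the implication just shown excludes \<open>R = 0\<close>, so
    \<open>R\<close> is positive.\<close>
  then show ?thesis using int main R_nonneg by force
qed

end
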